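(* Let $l$ be a positive integer. For $p=0,1,\dots,l$, $$F_{2,l}^{(2l-p,p)}(\alpha)=\sum_{s=0}^l\binom ls\,Q_p(s;-l-1,-l-1,l)\,\alpha^s=(1+\alpha)^{l-p}\,G_p^l(\alpha),$$ where $F_{2,l}^{(2l-p,p)}(\alpha)$, $Q_p$ and $G_p^l$ are defined in the context.
   Context: For a permutation $g$ of $N$ letters let $\nu(g)$ be $N$ minus its number of cycles. In $\mathfrak{S}_{2l}$ let $K\cong\mathfrak{S}_l\times\mathfrak{S}_l$ be the subgroup preserving $\{1,\dots,l\}$ and $\{l+1,\dots,2l\}$, and let $H=\{g\in\mathfrak{S}_{2l}:g(x)\equiv x\ (\mathrm{mod}\ l)\text{ for all }x\}\cong\mathfrak{S}_2^l$. For $\lambda\vdash2l$ let $\chi^\lambda$ be the irreducible character of $\mathfrak{S}_{2l}$ corresponding to $\lambda$ and $\omega^\lambda(g)=\frac1{|K|}\sum_{k\in K}\chi^\lambda(kg)$ the zonal spherical function. For $\lambda$ with at most two parts the transition matrix is the scalar $$F_{2,l}^\lambda(\alpha)=\sum_{h\in H}\alpha^{\nu(h)}\omega^\lambda(h).$$ The Hahn polynomial is $$Q_n(x;a,b,N)=\sum_{j=0}^N(-1)^j\binom nj\binom{-n-a-b-1}j\binom{-a-1}j^{-1}\binom Nj^{-1}\binom xj .$$ $G_n^\gamma(x)=F(-n,\gamma-n+1,-\gamma;-x)$, where $F(-n,b,c;x)=1+\sum_{k=1}^n\frac{(-n)_k(b)_k}{(c)_k}\frac{x^k}{k!}$ and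 $(a)_k=a(a+1)\cdots(a+k-1)$. *)

theory Defs
  imports
    Complex_Main
    "HOL-Library.Function_Algebras"
    "HOL-Number_Theory.Cong"
    "HOL-Combinatorics.Permutations"
    "HOL-Combinatorics.Orbits"
begin

text \<open>
  Permutations of \<open>N\<close> letters are functions \<open>g :: nat \<Rightarrow> nat\<close> with \<open>g permutes {1..N}\<close>; the
  product is composition. All scalars are complex.
\<close>

text \<open>Cycles are counted as orbits on \<open>{1..N}\<close>, so fixed points are cycles of length one.\<close>

definition nu :: "nat \<Rightarrow> (nat \<Rightarrow> nat) \<Rightarrow> nat" where
  "nu N g = N - card (orbit g ` {1..N})"


section \<open>Irreducible characters of the symmetric group\<close>

text \<open>
  The irreducible representation attached to a partition is its Specht module: the span of all
  polytabloids in the permutation module on tabloids. With this convention the partition with a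
  single part gives the trivial character. A partition is a weakly decreasing list; trailing
  zero parts do not change the diagram, so \<open>[n, 0]\<close> stands for the partition \<open>(n)\<close>.
\<close>

definition diagram :: "nat list \<Rightarrow> (nat \<times> nat) set" where
  "diagram la = {(i, j). i < length la \<and> j < la ! i}"

definition tableau :: "nat list \<Rightarrow> (nat \<times> nat \<Rightarrow> nat) \<Rightarrow> bool" where
  "tableau la t \<longleftrightarrow> bij_betw t (diagram la) {1..sum_list la}"

text \<open>A tabloid is the family of sets of entries in the rows of a tableau.\<close>

type_synonym tabloid = "nat \<Rightarrow> nat set"

definition tabloid_of :: "nat list \<Rightarrow> (nat \<times> nat \<Rightarrow> nat) \<Rightarrow> tabloid" where
  "tabloid_of la t = (\<lambda>i. t ` {c \<in> diagram la. fst c = i})"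

definition column :: "nat list \<Rightarrow> (nat \<times> nat \<Rightarrow> nat) \<Rightarrow> nat \<Rightarrow> nat set" where
  "column la t j = t ` {c \<in> diagram la. snd c = j}"

definition column_stabilizer :: "nat list \<Rightarrow> (nat \<times> nat \<Rightarrow> nat) \<Rightarrow> (nat \<Rightarrow> nat) set" where
  "column_stabilizer la t =
    {q. q permutes {1..sum_list la} \<and> (\<forall>j. q ` column la t j = column la t j)}"

text \<open>
  Formal linear combinations of tabloids are coefficient functions; the polytabloid of \<open>t\<close> is the
  signed sum of the tabloids \<open>{q t}\<close> over the column stabilizer.
\<close>

definition polytabloid :: "nat list \<Rightarrow> (nat \<times> nat \<Rightarrow> nat) \<Rightarrow> tabloid \<Rightarrow> complex" where
  "polytabloid la t = (\<lambda>T. \<Sum>q\<in>column_stabilizer la t.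
      if tabloid_of la (q \<circ> t) = T then of_int (sign q) else 0)"

definition cscale :: "complex \<Rightarrow> ('a \<Rightarrow> complex) \<Rightarrow> 'a \<Rightarrow> complex" where
  "cscale c f = (\<lambda>x. c * f x)"

global_interpretation cfun: vector_space cscale
  by unfold_locales (auto simp: cscale_def fun_eq_iff algebra_simps)

definition specht_module :: "nat list \<Rightarrow> (tabloid \<Rightarrow> complex) set" where
  "specht_module la = cfun.span {polytabloid la t | t. tableau la t}"

text \<open>
  Extending \<open>g \<cdot> T = (\<lambda>i. g ` T i)\<close> linearly, the coefficient of \<open>g \<cdot> f\<close> at \<open>T\<close> is that of \<open>f\<close> at
  \<open>g\<^sup>-\<^sup>1 \<cdot> T\<close>.
\<close>

definition tabloid_action :: "(nat \<Rightarrow> nat) \<Rightarrow> (tabloid \<Rightarrow> complex) \<Rightarrow> tabloid \<Rightarrow> complex" where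
  "tabloid_action g f = (\<lambda>T. f (\<lambda>i. inv g ` T i))"

text \<open>
  The trace of an endomorphism \<open>A\<close> of a finite-dimensional subspace \<open>V\<close>, independent of the
  chosen basis \<open>B\<close>.
\<close>

definition trace_on :: "('a \<Rightarrow> complex) set \<Rightarrow> (('a \<Rightarrow> complex) \<Rightarrow> 'a \<Rightarrow> complex) \<Rightarrow> complex" where
  "trace_on V A =
    (let B = (SOME B. cfun.independent B \<and> cfun.span B = V)
     in \<Sum>b\<in>B. cfun.representation B (A b) b)"

definition irr_char :: "nat list \<Rightarrow> (nat \<Rightarrow> nat) \<Rightarrow> complex" where
  "irr_char la g = trace_on (specht_module la) (tabloid_action g)"


section \<open>The scalar transition matrix\<close>

definition subgroup_K :: "nat \<Rightarrow> (nat \<Rightarrow> nat) set" where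
  "subgroup_K l = {g. g permutes {1..2 * l} \<and> g ` {1..l} = {1..l}
                      \<and> g ` {l + 1..2 * l} = {l + 1..2 * l}}"

definition subgroup_H :: "nat \<Rightarrow> (nat \<Rightarrow> nat) set" where
  "subgroup_H l = {g. g permutes {1..2 * l} \<and> (\<forall>x\<in>{1..2 * l}. [g x = x] (mod l))}"

definition zonal :: "nat \<Rightarrow> nat list \<Rightarrow> (nat \<Rightarrow> nat) \<Rightarrow> complex" where
  "zonal l la g = (1 / of_nat (card (subgroup_K l))) * (\<Sum>k\<in>subgroup_K l. irr_char la (k \<circ> g))"

definition F2 :: "nat \<Rightarrow> nat list \<Rightarrow> complex \<Rightarrow> complex" where
  "F2 l la \<alpha> = (\<Sum>h\<in>subgroup_H l. \<alpha> ^ nu (2 * l) h * zonal l la h)"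


section \<open>Hahn polynomials and the polynomials \<open>G\<close>\<close>

definition hahn_Q :: "nat \<Rightarrow> complex \<Rightarrow> complex \<Rightarrow> complex \<Rightarrow> nat \<Rightarrow> complex" where
  "hahn_Q n x a b N =
    (\<Sum>j=0..N. (-1) ^ j * of_nat (n choose j) * ((- of_nat n - a - b - 1) gchoose j)
        * inverse ((- a - 1) gchoose j) * inverse (of_nat (N choose j)) * (x gchoose j))"

text \<open>\<open>hyp_F n b c x\<close> is the terminating series \<open>F(-n, b, c; x)\<close>.\<close>

definition hyp_F :: "nat \<Rightarrow> complex \<Rightarrow> complex \<Rightarrow> complex \<Rightarrow> complex" where
  "hyp_F n b c x =
    1 + (\<Sum>k=1..n. pochhammer (- of_nat n) k * pochhammer b k / pochhammer c k * (x ^ k / fact k))"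

definition G_poly :: "nat \<Rightarrow> complex \<Rightarrow> complex \<Rightarrow> complex" where
  "G_poly n \<gamma> x = hyp_F n (\<gamma> - of_nat n + 1) (- \<gamma>) (- x)"

end

theory Submission
  imports Defs "HOL-Computational_Algebra.Formal_Power_Series"
begin

text \<open>
  The Specht module of \<open>(2l - p, p)\<close> consists of functions on the \<open>p\<close>-subsets of \<open>{1..2l}\<close> that
  satisfy the Garnir relations: the values on all \<open>p\<close>-subsets containing a given \<open>(p - 1)\<close>-subset
  sum to zero. For a function invariant under \<open>K\<close>, which depends only on \<open>|B \<inter> {1..l}|\<close>, these
  relations are a two-term recursion, so the invariants form a line; the zonal function at \<open>h\<close> is
  the trace of a rank-one map and equals the average over \<open>k \<in> K\<close> of the invariant function at
  \<open>h\<^sup>-\<^sup>1 k {l + 1..l + p}\<close>. Vandermonde's identity expands the invariant function in the binomials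
  \<open>i choose j\<close>, whose averages are found by double counting; this gives the Hahn polynomial at the
  number of letters that \<open>h\<close> moves from \<open>{1..l}\<close> to \<open>{l + 1..2l}\<close>, which is \<open>\<nu>(h)\<close> for \<open>h \<in> H\<close>.
\<close>


section \<open>Traces\<close>

lemma sum_fun_apply: "(\<Sum>a\<in>A. f a) x = (\<Sum>a\<in>A. f a x)"
  by (induction A rule: infinite_finite_induct) auto

text \<open>\<open>trace_on\<close> picks its basis by \<open>SOME\<close>, so the later
  computations all work with that one basis. Finite support puts \<open>V\<close> inside the span of
  the indicator functions of the points of \<open>D\<close>, which makes the chosen basis
  finite.\<close>

lemma subspace_basis:
  assumes "cfun.subspace V" "finite D" "\<forall>v\<in>V. \<forall>x. x \<notin> D \<longrightarrow> v x = 0"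
  obtains B where "cfun.independent B" "cfun.span B = V" "finite B"
    "\<And>A. trace_on V A = (\<Sum>b\<in>B. cfun.representation B (A b) b)"
proof -
  let ?P = "\<lambda>B. cfun.independent B \<and> cfun.span B = V"
  define B where "B = (SOME B. ?P B)"
  obtain B0 where B0: "B0 \<subseteq> V" "cfun.independent B0" "V \<subseteq> cfun.span B0"
    using cfun.maximal_independent_subset by blast
  have "cfun.span B0 = V"
    using B0 cfun.span_mono[OF B0(1)] assms(1) by (metis cfun.span_eq_iff subset_antisym)
  with B0 have "?P B0" by simp
  hence P: "?P B" unfolding B_def by (rule someI)
  let ?e = "\<lambda>d x. if x = d then 1 else (0 :: complex)"
  have "v \<in> cfun.span (?e ` D)" if "v \<in> V" for v
  proof -
    have "v = (\<Sum>d\<in>D. cscale (v d) (?e d))"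
    proof
      fix x
      have "(\<Sum>d\<in>D. cscale (v d) (?e d)) x = (\<Sum>d\<in>D. if x = d then v d else 0)"
        by (simp add: sum_fun_apply cscale_def if_distrib cong: if_cong)
      also have "\<dots> = v x" using assms(2,3) that by (auto simp: sum.delta')
      finally show "v x = (\<Sum>d\<in>D. cscale (v d) (?e d)) x" by simp
    qed
    also have "\<dots> \<in> cfun.span (?e ` D)"
      by (intro cfun.span_sum cfun.span_scale cfun.span_base) auto
    finally show ?thesis .
  qed
  hence "B \<subseteq> cfun.span (?e ` D)" using P cfun.span_superset by fastforce
  hence "finite B" using cfun.independent_span_bound[of "?e ` D" B] P assms(2) by auto
  with P that show thesis unfolding trace_on_def B_def Let_def by blast
qed

text \<open>\<open>cfun.representation\<close> is linear only on the span of the basis and returns 0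
  elsewhere, which is why every \<open>A i\<close> has to map \<open>V\<close> into itself.\<close>

lemma trace_on_sum:
  assumes "cfun.subspace V" "finite D" "\<forall>v\<in>V. \<forall>x. x \<notin> D \<longrightarrow> v x = 0"
    and A: "\<And>i v. i \<in> I \<Longrightarrow> v \<in> V \<Longrightarrow> A i v \<in> V"
  shows "(\<Sum>i\<in>I. trace_on V (A i)) = trace_on V (\<lambda>v. \<Sum>i\<in>I. A i v)"
proof -
  from subspace_basis[OF assms(1-3)] obtain B
    where B: "cfun.independent B" "cfun.span B = V" "finite B"
      "\<And>A. trace_on V A = (\<Sum>b\<in>B. cfun.representation B (A b) b)" by metis
  have "cfun.representation B (\<Sum>i\<in>I. A i b) = (\<lambda>c. \<Sum>i\<in>I. cfun.representation B (A i b) c)"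
    if "b \<in> B" for b
    using A B(2) that cfun.span_superset by (intro cfun.representation_sum[OF B(1)]) blast
  thus ?thesis by (simp add: B(4) sum.swap[of _ B])
qed

lemma trace_on_scale:
  assumes "cfun.subspace V" "finite D" "\<forall>v\<in>V. \<forall>x. x \<notin> D \<longrightarrow> v x = 0"
    and A: "\<And>v. v \<in> V \<Longrightarrow> A v \<in> V"
  shows "trace_on V (\<lambda>v. cscale c (A v)) = c * trace_on V A"
proof -
  from subspace_basis[OF assms(1-3)] obtain B
    where B: "cfun.independent B" "cfun.span B = V" "finite B"
      "\<And>A. trace_on V A = (\<Sum>b\<in>B. cfun.representation B (A b) b)" by metis
  have "cfun.representation B (cscale c (A b)) = (\<lambda>d. c * cfun.representation B (A b) d)"
    if "b \<in> B" for b
    using A B(2) that cfun.span_superset by (intro cfun.representation_scale[OF B(1)]) blast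
  thus ?thesis by (simp add: B(4) sum_distrib_left)
qed

text \<open>The diagonal entries are \<open>\<phi> b\<close> times the coordinate of
  \<open>u\<close> at \<open>b\<close>; by linearity their sum is \<open>\<phi>\<close> of the basis
  expansion of \<open>u\<close>.\<close>

lemma trace_on_rank_one:
  assumes "cfun.subspace V" "finite D" "\<forall>v\<in>V. \<forall>x. x \<notin> D \<longrightarrow> v x = 0"
    and u: "u \<in> V" and A: "\<And>v. v \<in> V \<Longrightarrow> A v = cscale (\<phi> v) u"
    and \<phi>: "\<And>v w. \<phi> (v + w) = \<phi> v + \<phi> w" "\<And>c v. \<phi> (cscale c v) = c * \<phi> v"
  shows "trace_on V A = \<phi> u"
proof -
  from subspace_basis[OF assms(1-3)] obtain B
    where B: "cfun.independent B" "cfun.span B = V" "finite B"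
      "\<And>A. trace_on V A = (\<Sum>b\<in>B. cfun.representation B (A b) b)" by metis
  have "\<phi> 0 = 0" using \<phi>(1)[of 0 0] by simp
  hence \<phi>_sum: "\<phi> (sum f X) = (\<Sum>x\<in>X. \<phi> (f x))" for f and X :: "('a \<Rightarrow> complex) set"
    by (induction X rule: infinite_finite_induct) (auto simp: \<phi>)
  have "A b = cscale (\<phi> b) u" if "b \<in> B" for b
    using A B(2) that cfun.span_superset by blast
  hence "trace_on V A = (\<Sum>b\<in>B. \<phi> b * cfun.representation B u b)"
    using u B(1,2) by (simp add: B(4) cfun.representation_scale)
  also have "\<dots> = \<phi> (\<Sum>b\<in>B. cscale (cfun.representation B u b) b)"
    by (simp add: \<phi>_sum \<phi> mult.commute)
  also have "\<dots> = \<phi> u" using B u by (simp add: cfun.sum_representation_eq)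
  finally show ?thesis .
qed

section \<open>Binomial identities\<close>

text \<open>In Pochhammer form this is \<open>(l-p+1)_i / (-l)_i\<close>. It will be the value of
  the normalised \<open>K\<close>-invariant function at a \<open>p\<close>-subset with
  \<open>i\<close> elements in \<open>{1..l}\<close>.\<close>

definition hahn_weight :: "nat \<Rightarrow> nat \<Rightarrow> nat \<Rightarrow> complex" where
  "hahn_weight l p i = (-1) ^ i * of_nat ((l - p + i) choose i) / of_nat (l choose i)"

text \<open>This is Vandermonde's convolution in disguise. Trinomial revision (\<open>div\<close>)
  replaces the denominator by one free of \<open>j\<close>, upper negation (\<open>neg\<close>)
  absorbs the alternating sign, and the two upper indices \<open>2l+1-p\<close> and
  \<open>-(l-i+1)\<close> add up to \<open>l-p+i\<close>.\<close>

lemma hahn_weight_expand: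
  assumes "i \<le> p" "p \<le> l"
  shows "(\<Sum>j=0..i. (-1) ^ j * of_nat (i choose j) * of_nat ((2 * l + 1 - p) choose j)
            / of_nat (l choose j)) = hahn_weight l p i"
proof -
  define M where "M = 2 * l + 1 - p"
  have neg: "of_nat ((l - j) choose (i - j))
      = (-1) ^ (i - j) * ((- (of_nat (l - i + 1)) :: complex) gchoose (i - j))" if "j \<le> i" for j
  proof -
    have "of_nat (l - i + 1) + of_nat (i - j) - 1 = (of_nat (l - j) :: complex)"
      using that assms by (simp add: of_nat_diff)
    thus ?thesis
      unfolding gbinomial_minus
      by (simp add: binomial_gbinomial flip: power_add mult.assoc power_mult_distrib)
  qed
  have div: "of_nat (i choose j) / of_nat (l choose j)
      = (of_nat ((l - j) choose (i - j)) / of_nat (l choose i) :: complex)" if "j \<le> i" for j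
  proof -
    have "(l choose i) * (i choose j) = (l choose j) * ((l - j) choose (i - j))"
      using that assms by (intro choose_mult) auto
    hence "of_nat (l choose i) * of_nat (i choose j)
        = (of_nat (l choose j) * of_nat ((l - j) choose (i - j)) :: complex)"
      by (metis of_nat_mult)
    thus ?thesis using that assms by (simp add: field_simps)
  qed
  have "(\<Sum>j=0..i. (-1) ^ j * of_nat (i choose j) * of_nat (M choose j) / of_nat (l choose j))
    = (\<Sum>j=0..i. (-1) ^ j * of_nat (M choose j) * (of_nat (i choose j) / of_nat (l choose j)) :: complex)"
    by (simp add: mult_ac)
  also have "\<dots> = (\<Sum>j=0..i. (-1) ^ i / of_nat (l choose i) * ((of_nat M gchoose j)
      * (- of_nat (l - i + 1) gchoose (i - j))))"
  proof (rule sum.cong[OF refl])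
    fix j assume j: "j \<in> {0..i}"
    hence "(-1) ^ i = ((-1) ^ j * (-1) ^ (i - j) :: complex)"
      by (simp flip: power_add)
    thus "(-1) ^ j * of_nat (M choose j) * (of_nat (i choose j) / of_nat (l choose j))
        = (-1) ^ i / of_nat (l choose i) * ((of_nat M gchoose j)
      * ((- of_nat (l - i + 1) :: complex) gchoose (i - j)))"
      using j by (simp add: div neg binomial_gbinomial[of M])
  qed
  also have "\<dots> = (-1) ^ i / of_nat (l choose i) * ((of_nat M + - of_nat (l - i + 1)) gchoose i)"
    by (simp only: sum_distrib_left[symmetric] gbinomial_Vandermonde)
  also have "of_nat M + - of_nat (l - i + 1) = (of_nat (l - p + i) :: complex)"
    using assms by (simp add: M_def of_nat_diff)
  finally show ?thesis by (simp add: hahn_weight_def binomial_gbinomial M_def)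
qed

text \<open>At \<open>a = b = -l-1\<close> the index \<open>-n-a-b-1\<close> becomes
  \<open>2l+1-p\<close> and \<open>-a-1\<close> becomes \<open>l\<close>, so all generalised
  binomials are ordinary ones; the terms with \<open>j > p\<close> vanish with
  \<open>p choose j\<close>.\<close>

lemma hahn_Q_eq:
  assumes "p \<le> l"
  shows "hahn_Q p (of_nat s) (- of_nat l - 1) (- of_nat l - 1) l
    = (\<Sum>j=0..p. (-1) ^ j * of_nat (p choose j) * of_nat ((2 * l + 1 - p) choose j)
          / of_nat (l choose j) * (of_nat (s choose j) / of_nat (l choose j)))"
proof -
  have 1: "- of_nat p - (- of_nat l - 1) - (- of_nat l - 1) - 1 = (of_nat (2 * l + 1 - p) :: complex)"
    using assms by (simp add: of_nat_diff)
  have "hahn_Q p (of_nat s) (- of_nat l - 1) (- of_nat l - 1) l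
    = (\<Sum>j=0..l. (-1) ^ j * of_nat (p choose j) * of_nat ((2 * l + 1 - p) choose j)
          / of_nat (l choose j) * (of_nat (s choose j) / of_nat (l choose j)))"
    unfolding hahn_Q_def 1 by (simp add: binomial_gbinomial[symmetric] field_simps)
  also have "\<dots> = (\<Sum>j=0..p. (-1) ^ j * of_nat (p choose j) * of_nat ((2 * l + 1 - p) choose j)
          / of_nat (l choose j) * (of_nat (s choose j) / of_nat (l choose j)))"
    using assms by (intro sum.mono_neutral_right) auto
  finally show ?thesis .
qed

text \<open>Trinomial revision pulls \<open>l choose j\<close> out of the sum, and the binomial
  theorem for exponent \<open>l - j\<close> evaluates the rest.\<close>

lemma sum_binomial_binomial_power:
  fixes \<alpha> :: "'a :: comm_ring_1"
  assumes "j \<le> l"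
  shows "(\<Sum>s=0..l. of_nat (l choose s) * of_nat (s choose j) * \<alpha> ^ s)
    = of_nat (l choose j) * \<alpha> ^ j * (1 + \<alpha>) ^ (l - j)"
proof -
  have "(\<Sum>s=0..l. of_nat (l choose s) * of_nat (s choose j) * \<alpha> ^ s)
      = (\<Sum>s=j..l. of_nat (l choose s) * of_nat (s choose j) * \<alpha> ^ s)"
    by (intro sum.mono_neutral_right) (auto simp: not_le binomial_eq_0)
  also have "\<dots> = (\<Sum>s=j..l. of_nat (l choose j) * \<alpha> ^ j * (of_nat ((l - j) choose (s - j)) * \<alpha> ^ (s - j)))"
  proof (rule sum.cong[OF refl])
    fix s assume s: "s \<in> {j..l}"
    hence "of_nat (l choose s) * of_nat (s choose j)
        = (of_nat (l choose j) * of_nat ((l - j) choose (s - j)) :: 'a)"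
      by (metis atLeastAtMost_iff choose_mult of_nat_mult)
    moreover have "\<alpha> ^ s = \<alpha> ^ j * \<alpha> ^ (s - j)" using s by (simp flip: power_add)
    ultimately show "of_nat (l choose s) * of_nat (s choose j) * \<alpha> ^ s
        = of_nat (l choose j) * \<alpha> ^ j * (of_nat ((l - j) choose (s - j)) * \<alpha> ^ (s - j))"
      by (simp add: mult_ac)
  qed
  also have "\<dots> = of_nat (l choose j) * \<alpha> ^ j * (\<Sum>s=j..l. of_nat ((l - j) choose (s - j)) * \<alpha> ^ (s - j))"
    by (simp add: sum_distrib_left)
  also have "(\<Sum>s=j..l. of_nat ((l - j) choose (s - j)) * \<alpha> ^ (s - j))
      = (\<Sum>t\<le>l - j. of_nat ((l - j) choose t) * \<alpha> ^ t)"
    using assms by (intro sum.reindex_bij_witness[of _ "\<lambda>t. t + j" "\<lambda>s. s - j"]) auto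
  also have "\<dots> = (1 + \<alpha>) ^ (l - j)"
    using binomial_ring[of \<alpha> 1 "l - j"] by (simp add: add.commute)
  finally show ?thesis .
qed

text \<open>Of the three signs \<open>(-1)^k\<close>, coming from \<open>(-p)_k\<close>,
  \<open>(-l)_k\<close> and \<open>(-\<alpha>)^k\<close>, one survives, and the factorials
  cancel.\<close>

lemma G_poly_eq:
  assumes "p \<le> l"
  shows "G_poly p (of_nat l) \<alpha> = (\<Sum>m=0..p. of_nat (p choose m) * hahn_weight l p m * \<alpha> ^ m)"
proof -
  have c: "pochhammer (- of_nat n) k = (-1) ^ k * fact k * (of_nat (n choose k) :: complex)" for n k
    using gbinomial_pochhammer[of "of_nat n :: complex" k]
    by (simp add: binomial_gbinomial flip: power_add power_mult_distrib mult.assoc)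
  have d: "pochhammer (of_nat l - of_nat p + 1) k = fact k * (of_nat ((l - p + k) choose k) :: complex)" for k
    using gbinomial_pochhammer'[of "of_nat (l - p + k) :: complex" k] assms
    by (simp add: binomial_gbinomial of_nat_diff)
  have "G_poly p (of_nat l) \<alpha> = 1 + (\<Sum>m=1..p. of_nat (p choose m) * hahn_weight l p m * \<alpha> ^ m)"
    unfolding G_poly_def hyp_F_def
  proof (intro arg_cong2[of _ _ _ _ "(+)"] refl sum.cong)
    fix k assume "k \<in> {1..p}"
    hence "(of_nat (l choose k) :: complex) \<noteq> 0" using assms by simp
    thus "pochhammer (- of_nat p) k * pochhammer (of_nat l - of_nat p + 1) k
         / pochhammer (- of_nat l) k * ((- \<alpha>) ^ k / fact k)
       = of_nat (p choose k) * hahn_weight l p k * \<alpha> ^ k"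
      unfolding c d hahn_weight_def by (subst power_minus) (simp add: field_simps)
  qed
  also have "\<dots> = (\<Sum>m=0..p. of_nat (p choose m) * hahn_weight l p m * \<alpha> ^ m)"
    by (simp add: sum.atLeast_Suc_atMost hahn_weight_def)
  finally show ?thesis .
qed

text \<open>The generating function identity is applied twice. With exponent \<open>l\<close> it
  evaluates the sum over \<open>s\<close>, and \<open>(1 + \<alpha>) ^ (l - p)\<close> splits off
  since \<open>j \<le> p\<close>. Read backwards with exponent \<open>p\<close> it restores powers
  of \<alpha>, whose coefficients \<open>hahn_weight_expand\<close> recognises.\<close>

lemma sum_hahn_Q:
  assumes "p \<le> l"
  shows "(\<Sum>s=0..l. of_nat (l choose s)
            * hahn_Q p (of_nat s) (- of_nat l - 1) (- of_nat l - 1) l * \<alpha> ^ s)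
       = (1 + \<alpha>) ^ (l - p) * G_poly p (of_nat l) \<alpha>"
proof -
  define a where "a j = ((-1) ^ j * of_nat ((2 * l + 1 - p) choose j) / of_nat (l choose j) :: complex)" for j
  have "(\<Sum>s=0..l. of_nat (l choose s)
            * hahn_Q p (of_nat s) (- of_nat l - 1) (- of_nat l - 1) l * \<alpha> ^ s)
      = (\<Sum>s=0..l. \<Sum>j=0..p. of_nat (p choose j) * a j / of_nat (l choose j)
             * (of_nat (l choose s) * of_nat (s choose j) * \<alpha> ^ s))"
    unfolding hahn_Q_eq[OF assms] a_def
    by (simp add: sum_distrib_left sum_distrib_right mult_ac)
  also have "\<dots> = (\<Sum>j=0..p. of_nat (p choose j) * a j / of_nat (l choose j)
             * (\<Sum>s=0..l. of_nat (l choose s) * of_nat (s choose j) * \<alpha> ^ s))"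
    by (subst sum.swap) (simp add: sum_distrib_left)
  also have "\<dots> = (\<Sum>j=0..p. (1 + \<alpha>) ^ (l - p) * (of_nat (p choose j) * a j * \<alpha> ^ j * (1 + \<alpha>) ^ (p - j)))"
  proof (rule sum.cong[OF refl])
    fix j assume j: "j \<in> {0..p}"
    hence "(1 + \<alpha>) ^ (l - j) = (1 + \<alpha>) ^ (l - p) * (1 + \<alpha>) ^ (p - j)"
      using assms by (simp flip: power_add)
    moreover have "(of_nat (l choose j) :: complex) \<noteq> 0" using j assms by simp
    ultimately show "of_nat (p choose j) * a j / of_nat (l choose j)
             * (\<Sum>s=0..l. of_nat (l choose s) * of_nat (s choose j) * \<alpha> ^ s)
        = (1 + \<alpha>) ^ (l - p) * (of_nat (p choose j) * a j * \<alpha> ^ j * (1 + \<alpha>) ^ (p - j))"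
      using j assms by (subst sum_binomial_binomial_power) auto
  qed
  \<comment> \<open>The binomial identity is used from right to left here, with \<open>p\<close> in
    place of \<open>l\<close>.\<close>
  also have "\<dots> = (1 + \<alpha>) ^ (l - p) * (\<Sum>j=0..p. a j * (\<Sum>m=0..p. of_nat (p choose m) * of_nat (m choose j) * \<alpha> ^ m))"
  proof -
    have "of_nat (p choose j) * a j * \<alpha> ^ j * (1 + \<alpha>) ^ (p - j)
        = a j * (\<Sum>m=0..p. of_nat (p choose m) * of_nat (m choose j) * \<alpha> ^ m)" if "j \<in> {0..p}" for j
      using that by (subst sum_binomial_binomial_power) auto
    hence "(\<Sum>j=0..p. of_nat (p choose j) * a j * \<alpha> ^ j * (1 + \<alpha>) ^ (p - j))
        = (\<Sum>j=0..p. a j * (\<Sum>m=0..p. of_nat (p choose m) * of_nat (m choose j) * \<alpha> ^ m))"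
      by (rule sum.cong[OF refl])
    thus ?thesis by (simp only: sum_distrib_left[symmetric])
  qed
  also have "(\<Sum>j=0..p. a j * (\<Sum>m=0..p. of_nat (p choose m) * of_nat (m choose j) * \<alpha> ^ m))
      = (\<Sum>m=0..p. of_nat (p choose m) * (\<Sum>j=0..p. of_nat (m choose j) * a j) * \<alpha> ^ m)"
    unfolding sum_distrib_left sum_distrib_right by (subst sum.swap) (simp add: mult_ac)
  also have "\<dots> = (\<Sum>m=0..p. of_nat (p choose m) * hahn_weight l p m * \<alpha> ^ m)"
  proof (rule sum.cong[OF refl])
    fix m assume m: "m \<in> {0..p}"
    have "(\<Sum>j=0..p. of_nat (m choose j) * a j) = (\<Sum>j=0..m. of_nat (m choose j) * a j)"
      using m by (intro sum.mono_neutral_right) auto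
    also have "\<dots> = hahn_weight l p m"
      using m assms by (subst hahn_weight_expand[symmetric]) (auto simp: a_def mult_ac)
    finally show "of_nat (p choose m) * (\<Sum>j=0..p. of_nat (m choose j) * a j) * \<alpha> ^ m
        = of_nat (p choose m) * hahn_weight l p m * \<alpha> ^ m" by simp
  qed
  finally show ?thesis by (simp add: G_poly_eq[OF assms])
qed



section \<open>The Specht module of a two-row partition\<close>

lemma tabloid_action_comp:
  assumes "bij g" "bij k"
  shows "tabloid_action (k \<circ> g) f = tabloid_action k (tabloid_action g f)"
  using assms by (simp add: tabloid_action_def o_inv_distrib image_comp)

lemma tabloid_action_add: "tabloid_action g (v + w) = tabloid_action g v + tabloid_action g w"
  by (simp add: tabloid_action_def fun_eq_iff)

lemma tabloid_action_cscale: "tabloid_action g (cscale c v) = cscale c (tabloid_action g v)"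
  by (simp add: tabloid_action_def cscale_def fun_eq_iff)

lemma column_comp: "column la (g \<circ> t) j = g ` column la t j"
  by (simp add: column_def image_comp)

lemma tabloid_of_comp: "tabloid_of la (g \<circ> t) = (\<lambda>i. g ` tabloid_of la t i)"
  by (simp add: tabloid_of_def image_comp)

lemma column_stabilizer_comp:
  assumes g: "g permutes {1..sum_list la}" and q: "q \<in> column_stabilizer la t"
  shows "g \<circ> q \<circ> inv g \<in> column_stabilizer la (g \<circ> t)"
proof -
  have "(g \<circ> q \<circ> inv g) permutes {1..sum_list la}"
    using g q by (auto simp: column_stabilizer_def intro!: permutes_compose permutes_inv)
  moreover have "(g \<circ> q \<circ> inv g) ` g ` column la t j = g ` q ` column la t j" for j
    by (simp add: image_image permutes_inverses[OF g])
  ultimately show ?thesis using q by (simp add: column_stabilizer_def column_comp)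
qed

lemma sign_conjugate:
  assumes "g permutes S" "q permutes S" "finite S"
  shows "sign (g \<circ> q \<circ> inv g) = sign q"
proof -
  have "permutation g" "permutation q" "permutation (inv g)"
    using assms permutes_inv by (blast intro: permutation_permutes[THEN iffD2])+
  thus ?thesis
    by (simp add: sign_compose permutation_compose sign_inverse mult.commute[of "sign g"] mult.assoc)
qed

text \<open>Conjugation by \<open>g\<close> carries the column stabilizer of \<open>t\<close> onto
  that of \<open>g \<circ> t\<close> and keeps signs, so the signed sums match term by term.
  Consequently the action permutes the generators of the Specht module.\<close>

lemma tabloid_action_polytabloid:
  assumes g: "g permutes {1..sum_list la}"
  shows "tabloid_action g (polytabloid la t) = polytabloid la (g \<circ> t)"
proof
  fix T
  have inv2: "inv g \<circ> (g \<circ> t) = t" 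
    using permutes_inv_o(2)[OF g] by (simp flip: comp_assoc)
  have ii: "inv (inv g) = g" using permutes_bij[OF g] by (rule inv_inv_eq)
  have eq: "tabloid_of la ((g \<circ> q \<circ> inv g) \<circ> (g \<circ> t)) = T
      \<longleftrightarrow> tabloid_of la (q \<circ> t) = (\<lambda>i. inv g ` T i)" for q
  proof -
    have "tabloid_of la ((g \<circ> q \<circ> inv g) \<circ> (g \<circ> t)) = (\<lambda>i. g ` tabloid_of la (q \<circ> t) i)"
      using inv2 by (simp add: comp_assoc tabloid_of_comp[of la g "q \<circ> t"])
    moreover have "g ` A = B \<longleftrightarrow> A = inv g ` B" for A B :: "nat set"
      by (auto simp: image_image permutes_inverses[OF g])
    ultimately show ?thesis by (auto simp: fun_eq_iff)
  qed
  have "polytabloid la (g \<circ> t) T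
      = (\<Sum>q\<in>column_stabilizer la t. if tabloid_of la ((g \<circ> q \<circ> inv g) \<circ> (g \<circ> t)) = T
            then of_int (sign (g \<circ> q \<circ> inv g)) else 0)"
    unfolding polytabloid_def
  proof (intro sum.reindex_bij_witness[of _ "\<lambda>q. g \<circ> q \<circ> inv g" "\<lambda>q. inv g \<circ> q \<circ> g"])
    fix q assume q: "q \<in> column_stabilizer la (g \<circ> t)"
    show "g \<circ> (inv g \<circ> q \<circ> g) \<circ> inv g = q"
      by (simp add: fun_eq_iff permutes_inverses[OF g])
    show "inv g \<circ> q \<circ> g \<in> column_stabilizer la t"
      using column_stabilizer_comp[OF permutes_inv[OF g] q] inv2 ii by simp
    show "(if tabloid_of la (g \<circ> (inv g \<circ> q \<circ> g) \<circ> inv g \<circ> (g \<circ> t)) = T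
            then of_int (sign (g \<circ> (inv g \<circ> q \<circ> g) \<circ> inv g)) else 0) =
         (if tabloid_of la (q \<circ> (g \<circ> t)) = T then of_int (sign q) else 0)"
      using \<open>g \<circ> (inv g \<circ> q \<circ> g) \<circ> inv g = q\<close> by simp
  next
    fix q assume q: "q \<in> column_stabilizer la t"
    show "inv g \<circ> (g \<circ> q \<circ> inv g) \<circ> g = q"
      by (simp add: fun_eq_iff permutes_inverses[OF g])
    show "g \<circ> q \<circ> inv g \<in> column_stabilizer la (g \<circ> t)"
      using column_stabilizer_comp[OF g q] .
  qed
  also have "\<dots> = polytabloid la t (\<lambda>i. inv g ` T i)"
    unfolding polytabloid_def eq
    by (intro sum.cong refl) (auto simp: column_stabilizer_def sign_conjugate[OF g])
  finally show "tabloid_action g (polytabloid la t) T = polytabloid la (g \<circ> t) T"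
    by (simp add: tabloid_action_def)
qed

lemma tabloid_action_specht_module:
  assumes g: "g permutes {1..sum_list la}" and f: "f \<in> specht_module la"
  shows "tabloid_action g f \<in> specht_module la"
  using f unfolding specht_module_def
proof (induction rule: cfun.span_induct_alt)
  case base
  have "tabloid_action g 0 = 0" by (simp add: tabloid_action_def fun_eq_iff)
  thus ?case by (metis cfun.span_zero zero_fun_def)
next
  case (step c x y)
  then obtain t where t: "x = polytabloid la t" "tableau la t" by blast
  have "tableau la (g \<circ> t)"
    using t(2) permutes_imp_bij[OF g] unfolding tableau_def by (rule bij_betw_trans)
  hence "tabloid_action g x \<in> cfun.span {polytabloid la t | t. tableau la t}"
    unfolding t(1) tabloid_action_polytabloid[OF g] by (blast intro: cfun.span_base)
  thus ?case using step unfolding tabloid_action_add tabloid_action_cscale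
    by (intro cfun.span_add cfun.span_scale) auto
qed

section \<open>Tabloids with two rows as subsets of the letters\<close>

text \<open>A tabloid with two rows is determined by its bottom row \<open>B\<close>; row indices
  above 1 receive the empty set, as in \<open>tabloid_of\<close>.\<close>

definition two_row :: "nat \<Rightarrow> nat set \<Rightarrow> tabloid" where
  "two_row n B = (\<lambda>i. if i = 0 then {1..n} - B else if i = 1 then B else {})"

lemma two_row_1 [simp]: "two_row n B (Suc 0) = B"
  by (simp add: two_row_def)

lemma two_row_eq_iff [simp]: "two_row n B = two_row n C \<longleftrightarrow> B = C"
  by (metis two_row_1)

lemma image_two_row:
  assumes "g permutes {1..n}"
  shows "(\<lambda>i. g ` two_row n B i) = two_row n (g ` B)"
  using permutes_image[OF assms] permutes_inj[OF assms]
  by (auto simp: two_row_def fun_eq_iff image_set_diff)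

lemma tabloid_action_two_row:
  assumes "g permutes {1..n}"
  shows "tabloid_action g f (two_row n B) = f (two_row n (inv g ` B))"
  by (simp add: tabloid_action_def image_two_row[OF permutes_inv[OF assms]])

lemma diagram_two_row: "diagram [a, b] = {0} \<times> {..<a} \<union> {1} \<times> {..<b}"
  by (auto simp: diagram_def less_Suc_eq nth_Cons split: nat.splits)

lemma tabloid_of_two_row:
  assumes "p \<le> n" and t: "tableau [n - p, p] t"
  shows "tabloid_of [n - p, p] t = two_row n (t ` ({1} \<times> {..<p}))"
proof
  fix i
  let ?D = "diagram [n - p, p]"
  have bij: "bij_betw t ?D {1..n}" using assms by (simp add: tableau_def)
  have row0: "{c \<in> ?D. fst c = 0} = ?D - {1} \<times> {..<p}"
    and row1: "{c \<in> ?D. fst c = 1} = {1} \<times> {..<p}"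
    and rows: "i > 1 \<Longrightarrow> {c \<in> ?D. fst c = i} = {}" for i
    by (auto simp: diagram_two_row)
  have sub: "{1} \<times> {..<p} \<subseteq> ?D" by (auto simp: diagram_two_row)
  have "t ` (?D - {1} \<times> {..<p}) = {1..n} - t ` ({1} \<times> {..<p})"
    using bij sub by (metis bij_betw_def inj_on_image_set_diff Diff_subset)
  thus "tabloid_of [n - p, p] t i = two_row n (t ` ({1} \<times> {..<p})) i"
    unfolding tabloid_of_def two_row_def using row0 row1 rows[of i] by auto
qed

lemma card_bottom_row:
  assumes "tableau [n - p, p] t"
  shows "card (t ` ({1} \<times> {..<p})) = p"
proof -
  have "inj_on t ({1} \<times> {..<p})"
    using assms unfolding tableau_def bij_betw_def
    by (auto simp: diagram_two_row intro: inj_on_subset)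
  thus ?thesis by (simp add: card_image)
qed

lemma tableau_permute:
  assumes "q permutes {1..sum_list la}" "tableau la t"
  shows "tableau la (q \<circ> t)"
  using assms permutes_imp_bij unfolding tableau_def by (blast intro: bij_betw_trans)

lemma polytabloid_two_row:
  assumes "p \<le> n" and t: "tableau [n - p, p] t"
  shows "polytabloid [n - p, p] t T = (\<Sum>q\<in>column_stabilizer [n - p, p] t.
      if two_row n (q ` t ` ({1} \<times> {..<p})) = T then of_int (sign q) else 0)"
  unfolding polytabloid_def
proof (intro sum.cong refl)
  fix q assume "q \<in> column_stabilizer [n - p, p] t"
  hence "tableau [n - p, p] (q \<circ> t)" using t by (auto simp: column_stabilizer_def intro: tableau_permute)
  from tabloid_of_two_row[OF assms(1) this]
  show "(if tabloid_of [n - p, p] (q \<circ> t) = T then of_int (sign q) else 0) =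
         (if two_row n (q ` t ` ({1} \<times> {..<p})) = T then of_int (sign q) else 0)"
    by (simp add: image_comp)
qed

lemma finite_column_stabilizer: "finite (column_stabilizer la t)"
  by (rule finite_subset[OF _ finite_permutations[of "{1..sum_list la}"]])
     (auto simp: column_stabilizer_def)

text \<open>Each \<open>q\<close> in the column stabilizer turns \<open>t\<close> into another
  tableau, whose bottom row is again a \<open>p\<close>-subset. This supplies the finite support
  that the trace lemmas ask for.\<close>

lemma specht_two_row_support:
  assumes p: "p \<le> n" and f: "f \<in> specht_module [n - p, p]"
    and T: "T \<notin> two_row n ` {B. B \<subseteq> {1..n} \<and> card B = p}"
  shows "f T = 0"
  using f unfolding specht_module_def
proof (induction rule: cfun.span_induct_alt)
  case (step c x y)
  then obtain t where t: "x = polytabloid [n - p, p] t" "tableau [n - p, p] t" by blast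
  have "two_row n (q ` t ` ({1} \<times> {..<p})) \<noteq> T" if q: "q \<in> column_stabilizer [n - p, p] t" for q
  proof -
    have "tableau [n - p, p] (q \<circ> t)" using t q by (auto simp: column_stabilizer_def intro: tableau_permute)
    hence "card (q ` t ` ({1} \<times> {..<p})) = p" "q ` t ` ({1} \<times> {..<p}) \<subseteq> {1..n}"
      using p card_bottom_row[of n p "q \<circ> t"]
      by (auto simp: tableau_def bij_betw_def image_comp diagram_two_row)
    thus ?thesis using T by blast
  qed
  hence "x T = 0" unfolding t(1) polytabloid_two_row[OF p t(2)] by simp
  thus ?case using step by (simp add: cscale_def)
qed simp



section \<open>Garnir relations and column stabilizers\<close>

lemma transpose_in_column_stabilizer:
  assumes t: "tableau la t" and j: "(a, j) \<in> diagram la" "(b, j) \<in> diagram la"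
  shows "transpose (t (a, j)) (t (b, j)) \<in> column_stabilizer la t"
proof -
  have bij: "bij_betw t (diagram la) {1..sum_list la}" using t by (simp add: tableau_def)
  have "transpose (t (a, j)) (t (b, j)) ` column la t k = column la t k" for k
  proof (cases "k = j")
    case True
    hence "t (a, j) \<in> column la t k" "t (b, j) \<in> column la t k"
      using j unfolding column_def by force+
    thus ?thesis by (simp add: transpose_image_eq)
  next
    case False
    have "t (c, j) \<notin> column la t k" if "(c, j) \<in> diagram la" for c
      using that False bij unfolding column_def bij_betw_def inj_on_def by fastforce
    thus ?thesis using j by (simp add: transpose_image_eq)
  qed
  moreover have "t (a, j) \<in> {1..sum_list la}" "t (b, j) \<in> {1..sum_list la}"
    using bij j bij_betwE by blast+
  ultimately show ?thesis
    by (simp add: column_stabilizer_def permutes_swap_id)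
qed

lemma column_stabilizer_mult:
  assumes "q \<in> column_stabilizer la t" "r \<in> column_stabilizer la t"
  shows "q \<circ> r \<in> column_stabilizer la t"
proof -
  have "(q \<circ> r) ` column la t j = q ` r ` column la t j" for j by (simp add: image_image)
  thus ?thesis using assms by (simp add: column_stabilizer_def permutes_compose)
qed

text \<open>A sign-reversing involution on each polytabloid. The set \<open>C\<close> has only
  \<open>p - 1\<close> elements, so it misses one of the \<open>p\<close> columns of height two;
  composing with the transposition of that column flips the sign and does not affect whether the
  bottom row contains \<open>C\<close>.\<close>

lemma specht_two_row_relation:
  assumes p: "2 * p \<le> n" and f: "f \<in> specht_module [n - p, p]"
    and C: "C \<subseteq> {1..n}" "Suc (card C) = p"
  shows "(\<Sum>x\<in>{1..n} - C. f (two_row n (insert x C))) = 0"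
  using f unfolding specht_module_def
proof (induction rule: cfun.span_induct_alt)
  case (step c f y)
  then obtain t where f: "f = polytabloid [n - p, p] t" and t: "tableau [n - p, p] t" by blast
  have pn: "p \<le> n" and fC: "finite C" using p C finite_subset by auto
  have bij: "bij_betw t (diagram [n - p, p]) {1..n}" using t pn by (simp add: tableau_def)
  define Q where "Q = column_stabilizer [n - p, p] t"
  define R where "R = t ` ({1} \<times> {..<p})"
  have Q: "q permutes {1..n}" if "q \<in> Q" for q
    using that pn by (simp add: Q_def column_stabilizer_def)
  have cardR: "card (q ` R) = p" if "q \<in> Q" for q
    using card_bottom_row[OF t] permutes_inj[OF Q[OF that]]
    by (simp add: R_def card_image inj_on_subset)
  have R: "R \<subseteq> {1..n}" using bij by (auto simp: R_def bij_betw_def diagram_two_row)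
  \<comment> \<open>A bottom row containing \<open>C\<close> exceeds it by exactly one letter, so it
    is counted for exactly one \<open>x\<close>.\<close>
  have inner: "(\<Sum>x\<in>{1..n} - C. if q ` R = insert x C then s else 0) = (if C \<subseteq> q ` R then s else 0)"
    if q: "q \<in> Q" for q and s :: complex
  proof (cases "C \<subseteq> q ` R")
    case True
    have "card (q ` R - C) = 1" using cardR[OF q] True C fC by (simp add: card_Diff_subset)
    then obtain y where y: "q ` R - C = {y}" by (auto simp: card_1_singleton_iff)
    have "q ` R \<subseteq> {1..n}" using R permutes_image[OF Q[OF q]] by blast
    hence "y \<in> {1..n} - C" using y by blast
    moreover have "q ` R = insert x C \<longleftrightarrow> x = y" if "x \<in> {1..n} - C" for x
      using y True that by auto
    hence "(\<Sum>x\<in>{1..n} - C. if q ` R = insert x C then s else 0) = (\<Sum>x\<in>{1..n} - C. if x = y then s else 0)"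
      by (intro sum.cong) auto
    ultimately show ?thesis using True by (simp add: sum.delta)
  next
    case False
    hence "q ` R \<noteq> insert x C" for x by blast
    thus ?thesis using False by simp
  qed
  have "(\<Sum>x\<in>{1..n} - C. f (two_row n (insert x C)))
      = (\<Sum>q\<in>Q. \<Sum>x\<in>{1..n} - C. if q ` R = insert x C then of_int (sign q) else 0)"
    unfolding f polytabloid_two_row[OF pn t] R_def Q_def by (subst sum.swap) simp
  also have "\<dots> = (\<Sum>q\<in>Q. if C \<subseteq> q ` R then of_int (sign q) else 0)"
    by (intro sum.cong inner refl)
  also have "\<dots> = 0"
  proof -
    \<comment> \<open>The columns that meet \<open>C\<close>; there are fewer than \<open>p\<close>
      of them.\<close>
    let ?J = "snd ` inv_into (diagram [n - p, p]) t ` C"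
    have "card ?J \<le> card C"
      unfolding image_image by (rule card_image_le[OF fC])
    hence "\<not> {..<p} \<subseteq> ?J" using C(2) card_mono[of ?J "{..<p}"] fC by auto
    then obtain j where j: "j < p" "j \<notin> ?J" by auto
    have in_diag: "(0, j) \<in> diagram [n - p, p]" "(1, j) \<in> diagram [n - p, p]"
      using j p by (auto simp: diagram_two_row)
    have notC: "t (i, j) \<notin> C" if "(i, j) \<in> diagram [n - p, p]" for i
      using j(2) bij_betw_inv_into_left[OF bij that] by (force simp: image_image)
    define \<tau> where "\<tau> = transpose (t (0, j)) (t (1, j))"
    have \<tau>: "\<tau> \<in> Q" unfolding \<tau>_def Q_def
      by (rule transpose_in_column_stabilizer[OF t in_diag])
    have ne: "t (0, j) \<noteq> t (1, j)"
      using inj_onD[OF bij_betw_imp_inj_on[OF bij] _ in_diag] by auto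
    have sub: "C \<subseteq> (\<tau> \<circ> q) ` R \<longleftrightarrow> C \<subseteq> q ` R" for q
    proof -
      have fixC: "\<tau> c = c" if "c \<in> C" for c
        using that notC[OF in_diag(1)] notC[OF in_diag(2)]
        unfolding \<tau>_def by (intro transpose_apply_other) auto
      have inv: "\<tau> (\<tau> x) = x" for x by (simp add: \<tau>_def)
      show ?thesis
      proof
        assume sub: "C \<subseteq> (\<tau> \<circ> q) ` R"
        show "C \<subseteq> q ` R"
        proof
          fix c assume c: "c \<in> C"
          then obtain r where "r \<in> R" "c = \<tau> (q r)" using sub by auto
          thus "c \<in> q ` R" using fixC[OF c] inv[of "q r"] by auto
        qed
      next
        assume sub: "C \<subseteq> q ` R"
        show "C \<subseteq> (\<tau> \<circ> q) ` R"
        proof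
          fix c assume c: "c \<in> C"
          then obtain r where "r \<in> R" "c = q r" using sub by auto
          thus "c \<in> (\<tau> \<circ> q) ` R" using fixC[OF c] by force
        qed
      qed
    qed
    let ?s = "\<lambda>q. if C \<subseteq> q ` R then of_int (sign q) else (0 :: complex)"
    have "?s (\<tau> \<circ> q) = - ?s q" if "q \<in> Q" for q
    proof -
      have "permutation q" "permutation \<tau>" using Q[OF that] Q[OF \<tau>]
        by (auto simp: permutation_permutes)
      hence "sign (\<tau> \<circ> q) = - sign q"
        using ne by (simp add: sign_compose \<tau>_def sign_swap_id)
      thus ?thesis unfolding sub by simp
    qed
    \<comment> \<open>Reindexing by \<open>q \<mapsto> \<tau> \<circ> q\<close> shows that the sum
      is its own negative.\<close>
    hence "sum ?s Q = (\<Sum>q\<in>Q. - ?s (\<tau> \<circ> q))" by simp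
    also have "(\<Sum>q\<in>Q. - ?s (\<tau> \<circ> q)) = (\<Sum>q\<in>Q. - ?s q)"
    proof (intro sum.reindex_bij_witness[of _ "\<lambda>q. \<tau> \<circ> q" "\<lambda>q. \<tau> \<circ> q"] refl)
      fix q assume q: "q \<in> Q"
      show "\<tau> \<circ> (\<tau> \<circ> q) = q" by (simp add: \<tau>_def fun_eq_iff)
      thus "\<tau> \<circ> (\<tau> \<circ> q) = q" .
      show "\<tau> \<circ> q \<in> Q"
        using \<tau> q unfolding Q_def by (rule column_stabilizer_mult)
      thus "\<tau> \<circ> q \<in> Q" .
    qed
    finally show ?thesis by (simp add: sum_negf)
  qed
  finally show ?case using step(2)
    by (simp add: cscale_def sum.distrib flip: sum_distrib_left)
qed simp

text \<open>Columns have at most two entries. Once the lower one is fixed, injectivity leaves the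
  upper one no other place to go.\<close>

lemma column_stabilizer_fixing_bottom_row:
  assumes p: "2 * p \<le> n" and t: "tableau [n - p, p] t"
    and q: "q \<in> column_stabilizer [n - p, p] t" "\<And>j. j < p \<Longrightarrow> q (t (1, j)) = t (1, j)"
  shows "q = id"
proof
  fix x
  have bij: "bij_betw t (diagram [n - p, p]) {1..n}" using t p by (simp add: tableau_def)
  have perm: "q permutes {1..n}" using q p by (simp add: column_stabilizer_def)
  have top: "q (t (0, j)) = t (0, j)" if j: "j < n - p" for j
  proof -
    have "t (0, j) \<in> column [n - p, p] t j" using j by (force simp: column_def diagram_two_row)
    hence "q (t (0, j)) \<in> column [n - p, p] t j" using q(1) by (auto simp: column_stabilizer_def)
    then consider "q (t (0, j)) = t (0, j)" | "j < p" "q (t (0, j)) = t (1, j)"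
      by (auto simp: column_def diagram_two_row)
    thus ?thesis
    proof cases
      case 2
      hence "t (0, j) = t (1, j)" using q(2) permutes_inj[OF perm] by (metis injD)
      moreover have in_diag: "(0, j) \<in> diagram [n - p, p]" "(1, j) \<in> diagram [n - p, p]"
        using j 2 by (auto simp: diagram_two_row)
      ultimately show ?thesis using inj_onD[OF bij_betw_imp_inj_on[OF bij] _ in_diag] by auto
    qed
  qed
  show "q x = id x"
  proof (cases "x \<in> {1..n}")
    case True
    then obtain i j where "(i, j) \<in> diagram [n - p, p]" "x = t (i, j)"
      using bij unfolding bij_betw_def by fast
    thus ?thesis using top q(2) by (auto simp: diagram_two_row)
  next
    case False
    thus ?thesis using permutes_not_in[OF perm] by simp
  qed
qed



section \<open>Functions invariant under \<open>K\<close>\<close>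

lemma subgroup_K_permutes: "k \<in> subgroup_K l \<Longrightarrow> k permutes {1..2 * l}"
  by (simp add: subgroup_K_def)

lemma subgroup_K_image_lower: "k \<in> subgroup_K l \<Longrightarrow> k ` {1..l} = {1..l}"
  by (simp add: subgroup_K_def)

lemma subgroup_K_image_upper: "k \<in> subgroup_K l \<Longrightarrow> k ` {l + 1..2 * l} = {l + 1..2 * l}"
  by (simp add: subgroup_K_def)

lemma finite_subgroup_K: "finite (subgroup_K l)"
  by (rule finite_subset[OF _ finite_permutations[of "{1..2 * l}"]]) (auto simp: subgroup_K_def)

lemma id_in_subgroup_K: "id \<in> subgroup_K l"
  by (simp add: subgroup_K_def permutes_id)

lemma card_subgroup_K: "card (subgroup_K l) > 0"
  using finite_subgroup_K id_in_subgroup_K card_gt_0_iff by blast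

lemma subgroup_K_comp:
  assumes "g \<in> subgroup_K l" "k \<in> subgroup_K l"
  shows "g \<circ> k \<in> subgroup_K l"
proof -
  have "(g \<circ> k) ` A = g ` k ` A" for A by (simp add: image_image)
  thus ?thesis using assms by (simp add: subgroup_K_def permutes_compose)
qed

lemma subgroup_K_inv:
  assumes "k \<in> subgroup_K l"
  shows "inv k \<in> subgroup_K l"
proof -
  note k = subgroup_K_permutes[OF assms]
  have inv: "inv k ` k ` A = A" for A by (simp add: image_image permutes_inverses[OF k])
  show ?thesis
    using inv[of "{1..l}"] inv[of "{l + 1..2 * l}"] permutes_inv[OF k]
    unfolding subgroup_K_image_lower[OF assms] subgroup_K_image_upper[OF assms]
    by (simp add: subgroup_K_def)
qed

lemma sum_subgroup_K_inv: "(\<Sum>k\<in>subgroup_K l. F (inv k)) = (\<Sum>k\<in>subgroup_K l. F k)"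
  by (rule sum.reindex_bij_witness[of _ inv inv])
     (auto simp: subgroup_K_inv inv_inv_eq[OF permutes_bij[OF subgroup_K_permutes]])

lemma sum_subgroup_K_comp:
  assumes g: "g \<in> subgroup_K l"
  shows "(\<Sum>k\<in>subgroup_K l. F (g \<circ> k)) = (\<Sum>k\<in>subgroup_K l. F k)"
proof (rule sum.reindex_bij_witness[of _ "\<lambda>k. inv g \<circ> k" "\<lambda>k. g \<circ> k"])
  note p = permutes_inverses[OF subgroup_K_permutes[OF g]]
  show "inv g \<circ> (g \<circ> k) = k" "g \<circ> (inv g \<circ> k) = k" for k
    by (simp_all add: fun_eq_iff p)
qed (auto simp: g subgroup_K_inv subgroup_K_comp)

section \<open>Orbits of \<open>K\<close> on subsets\<close>

lemma permutation_mapping_subset: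
  assumes S: "finite S" and A: "A \<subseteq> S" "B \<subseteq> S" "card A = card B"
  shows "\<exists>\<sigma>. \<sigma> permutes S \<and> \<sigma> ` A = B"
proof -
  have fin: "finite A" "finite B" using S A finite_subset by auto
  obtain f where f: "bij_betw f A B" using finite_same_card_bij[OF fin A(3)] by blast
  have "card (S - A) = card (S - B)" using fin A by (simp add: card_Diff_subset)
  then obtain g where g: "bij_betw g (S - A) (S - B)"
    using finite_same_card_bij[of "S - A" "S - B"] S by blast
  define \<sigma> where "\<sigma> x = (if x \<in> A then f x else if x \<in> S then g x else x)" for x
  have 1: "bij_betw \<sigma> A B" using f by (rule bij_betw_cong[THEN iffD1, rotated]) (simp add: \<sigma>_def)
  have 2: "bij_betw \<sigma> (S - A) (S - B)"
    using g by (rule bij_betw_cong[THEN iffD1, rotated]) (simp add: \<sigma>_def)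
  have "bij_betw \<sigma> (A \<union> (S - A)) (B \<union> (S - B))"
    using 1 2 by (rule bij_betw_combine) auto
  hence "bij_betw \<sigma> S S" using A by (simp add: Un_absorb1)
  hence "\<sigma> permutes S" using A by (intro bij_imp_permutes) (auto simp: \<sigma>_def)
  thus ?thesis using 1 bij_betw_imp_surj_on by blast
qed

lemma split_halves:
  fixes Z :: "nat set"
  assumes "Z \<subseteq> {1..2 * l}"
  shows "Z = (Z \<inter> {1..l}) \<union> (Z \<inter> {l + 1..2 * l})"
  using assms by auto

lemma card_split_halves:
  fixes Z :: "nat set"
  assumes "Z \<subseteq> {1..2 * l}"
  shows "card Z = card (Z \<inter> {1..l}) + card (Z \<inter> {l + 1..2 * l})"
  by (subst split_halves[OF assms], subst card_Un_disjoint) auto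

text \<open>The sizes of the two intersections classify the orbits: the halves are permuted
  independently, by \<open>\<sigma>\<close> and \<open>\<tau>\<close>, each of which is the identity
  on the other half.\<close>

lemma subgroup_K_transitive:
  assumes X: "X \<subseteq> {1..2 * l}" "Y \<subseteq> {1..2 * l}" "card X = card Y"
    and low: "card (X \<inter> {1..l}) = card (Y \<inter> {1..l})"
  shows "\<exists>k\<in>subgroup_K l. k ` X = Y"
proof -
  have up: "card (X \<inter> {l + 1..2 * l}) = card (Y \<inter> {l + 1..2 * l})"
    using X low card_split_halves[of X l] card_split_halves[of Y l] by simp
  obtain \<sigma> where \<sigma>: "\<sigma> permutes {1..l}" "\<sigma> ` (X \<inter> {1..l}) = Y \<inter> {1..l}"
    using permutation_mapping_subset[OF _ _ _ low] by blast
  obtain \<tau> where \<tau>: "\<tau> permutes {l + 1..2 * l}" "\<tau> ` (X \<inter> {l + 1..2 * l}) = Y \<inter> {l + 1..2 * l}"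
    using permutation_mapping_subset[OF _ _ _ up] by blast
  have low_eq: "(\<sigma> \<circ> \<tau>) ` A = \<sigma> ` A" if "A \<subseteq> {1..l}" for A
    using that by (intro image_cong refl) (auto intro!: arg_cong[where f = \<sigma>] permutes_not_in[OF \<tau>(1)])
  have up_eq: "(\<sigma> \<circ> \<tau>) ` A = \<tau> ` A" if "A \<subseteq> {l + 1..2 * l}" for A
  proof (intro image_cong refl)
    fix x assume "x \<in> A"
    hence "\<tau> x \<in> {l + 1..2 * l}" using that permutes_in_image[OF \<tau>(1)] by blast
    thus "(\<sigma> \<circ> \<tau>) x = \<tau> x" using permutes_not_in[OF \<sigma>(1), of "\<tau> x"] by simp
  qed
  have "(\<sigma> \<circ> \<tau>) permutes {1..2 * l}"
    using permutes_subset[OF \<sigma>(1), of "{1..2 * l}"] permutes_subset[OF \<tau>(1), of "{1..2 * l}"]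
    by (intro permutes_compose) auto
  hence "\<sigma> \<circ> \<tau> \<in> subgroup_K l"
    unfolding subgroup_K_def
    using low_eq[of "{1..l}"] up_eq[of "{l + 1..2 * l}"] permutes_image[OF \<sigma>(1)] permutes_image[OF \<tau>(1)]
    by simp
  moreover have "(\<sigma> \<circ> \<tau>) ` X = Y"
  proof -
    have "(\<sigma> \<circ> \<tau>) ` X = (\<sigma> \<circ> \<tau>) ` (X \<inter> {1..l}) \<union> (\<sigma> \<circ> \<tau>) ` (X \<inter> {l + 1..2 * l})"
      using split_halves[OF X(1)] by (metis image_Un)
    also have "\<dots> = (Y \<inter> {1..l}) \<union> (Y \<inter> {l + 1..2 * l})"
      by (simp only: low_eq[OF Int_lower2] up_eq[OF Int_lower2] \<sigma> \<tau>)
    finally show ?thesis using split_halves[OF X(2)] by simp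
  qed
  ultimately show ?thesis by blast
qed

text \<open>The ratio of consecutive weights, cleared of denominators into the form in which the
  Garnir relation delivers it; both binomials are handled by absorption.\<close>

lemma hahn_weight_Suc:
  assumes "i < l"
  shows "of_nat (l - i) * hahn_weight l p (Suc i) = - of_nat (l - p + Suc i) * hahn_weight l p i"
proof -
  have 1: "of_nat (Suc i) * of_nat ((l - p + Suc i) choose Suc i)
      = (of_nat (l - p + Suc i) * of_nat ((l - p + i) choose i) :: complex)"
    by (metis Suc_times_binomial_eq add_Suc_right mult.commute of_nat_mult)
  have "(l choose Suc i) * (Suc i choose i) = (l choose i) * ((l - i) choose (Suc i - i))"
    using assms by (intro choose_mult) auto
  hence "(l choose Suc i) * Suc i = (l choose i) * (l - i)" using assms by simp
  hence "of_nat (l choose Suc i) * of_nat (Suc i) = (of_nat (l choose i) * of_nat (l - i) :: complex)"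
    by (metis of_nat_mult)
  moreover have "(of_nat (l choose i) :: complex) \<noteq> 0" "(of_nat (l choose Suc i) :: complex) \<noteq> 0"
    using assms by simp_all
  ultimately have 2: "of_nat (l - i) / of_nat (l choose Suc i) = (of_nat (Suc i) / of_nat (l choose i) :: complex)"
    by (simp add: divide_eq_eq eq_divide_eq mult.commute)
  have "of_nat (l - i) * hahn_weight l p (Suc i)
      = (-1) ^ Suc i * of_nat ((l - p + Suc i) choose Suc i) * (of_nat (l - i) / of_nat (l choose Suc i))"
    by (simp only: hahn_weight_def times_divide_eq_right mult_ac)
  also have "\<dots> = - ((-1) ^ i * (of_nat (Suc i) * of_nat ((l - p + Suc i) choose Suc i)) / of_nat (l choose i))"
    unfolding 2 by (simp only: power_Suc times_divide_eq_right mult_ac) simp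
  also have "\<dots> = - of_nat (l - p + Suc i) * hahn_weight l p i"
    unfolding 1 hahn_weight_def by (simp add: mult_ac del: of_nat_add of_nat_Suc)
  finally show ?thesis .
qed

text \<open>The value 0 off the tabloids of \<open>p\<close>-subsets agrees with the support of the
  Specht module. At subsets disjoint from \<open>{1..l}\<close> the value is 1, which normalises the
  function.\<close>

definition spherical :: "nat \<Rightarrow> nat \<Rightarrow> tabloid \<Rightarrow> complex" where
  "spherical l p T = (if T \<in> two_row (2 * l) ` {B. B \<subseteq> {1..2 * l} \<and> card B = p}
      then hahn_weight l p (card (T 1 \<inter> {1..l})) else 0)"

lemma spherical_two_row:
  assumes "B \<subseteq> {1..2 * l}" "card B = p"
  shows "spherical l p (two_row (2 * l) B) = hahn_weight l p (card (B \<inter> {1..l}))"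
  using assms by (auto simp: spherical_def)

text \<open>
  The Garnir relation for a \<open>(p - 1)\<close>-subset meeting \<open>{1..l}\<close> in \<open>i\<close> points is a two-term
  recursion for the values of an invariant function, solved by \<open>hahn_weight\<close>.
\<close>

lemma invariant_eq_spherical:
  assumes p: "p \<le> l" and f: "f \<in> specht_module [2 * l - p, p]"
    and inv: "\<And>k B. k \<in> subgroup_K l \<Longrightarrow> f (two_row (2 * l) (k ` B)) = f (two_row (2 * l) B)"
  shows "f = cscale (f (two_row (2 * l) {l + 1..l + p})) (spherical l p)"
proof -
  let ?f = "\<lambda>B. f (two_row (2 * l) B)"
  define c where "c = ?f {l + 1..l + p}"
  have eq: "?f X = ?f Y" if "X \<subseteq> {1..2 * l}" "Y \<subseteq> {1..2 * l}" "card X = card Y"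
    "card (X \<inter> {1..l}) = card (Y \<inter> {1..l})" for X Y
    using subgroup_K_transitive[OF that] inv by metis
  have "?f B = c * hahn_weight l p i"
    if "B \<subseteq> {1..2 * l}" "card B = p" "card (B \<inter> {1..l}) = i" for B i
    using that
  proof (induction i arbitrary: B)
    case 0
    have "{l + 1..l + p} \<inter> {1..l} = {}" by auto
    hence "?f B = c" unfolding c_def using p 0 by (intro eq) auto
    thus ?case by (simp add: hahn_weight_def)
  next
    case (Suc i)
    have finB: "finite B" using Suc.prems finite_subset by blast
    obtain b where b: "b \<in> B" "b \<in> {1..l}"
      using Suc.prems(3) by (metis Int_iff card.empty equals0I nat.distinct(1))
    \<comment> \<open>Adding a lower letter to \<open>C\<close> gives a set in the orbit of
      \<open>B\<close>; adding an upper letter gives one with only \<open>i\<close> lower letters,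
      covered by the induction hypothesis.\<close>
    define C where "C = B - {b}"
    have C: "finite C" "C \<subseteq> {1..2 * l}" "Suc (card C) = p" "b \<notin> C"
      using finB Suc.prems card_Suc_Diff1[OF finB b(1)] by (auto simp: C_def)
    have "B \<inter> {1..l} = insert b (C \<inter> {1..l})" using b by (auto simp: C_def)
    hence Ci: "card (C \<inter> {1..l}) = i" using Suc.prems(3) C by simp
    \<comment> \<open>This makes the factor \<open>l - i\<close> nonzero, so that it can be
      cancelled at the end.\<close>
    have il: "i < l" using Suc.prems(3) card_mono[of "{1..l}" "B \<inter> {1..l}"] by simp
    have Cu: "Suc (i + card (C \<inter> {l + 1..2 * l})) = p" using Ci C(3) card_split_halves[OF C(2)] by simp
    have low: "?f (insert x C) = ?f B" if "x \<in> {1..l} - C" for x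
    proof (rule eq)
      have "insert x C \<inter> {1..l} = insert x (C \<inter> {1..l})" using that by auto
      thus "card (insert x C \<inter> {1..l}) = card (B \<inter> {1..l})" using Ci C that Suc.prems(3) by simp
    qed (use that C Suc.prems in auto)
    have up: "?f (insert x C) = c * hahn_weight l p i" if "x \<in> {l + 1..2 * l} - C" for x
    proof (rule Suc.IH)
      have "insert x C \<inter> {1..l} = C \<inter> {1..l}" using that by auto
      thus "card (insert x C \<inter> {1..l}) = i" using Ci by simp
    qed (use that C in auto)
    have "0 = (\<Sum>x\<in>{1..2 * l} - C. ?f (insert x C))"
      using specht_two_row_relation[OF _ f C(2,3)] p by simp
    also have "{1..2 * l} - C = ({1..l} - C) \<union> ({l + 1..2 * l} - C)" by auto
    also have "(\<Sum>x\<in>\<dots>. ?f (insert x C))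
        = (\<Sum>x\<in>{1..l} - C. ?f (insert x C)) + (\<Sum>x\<in>{l + 1..2 * l} - C. ?f (insert x C))"
      by (rule sum.union_disjoint) auto
    also have "\<dots> = of_nat (card ({1..l} - C)) * ?f B
        + of_nat (card ({l + 1..2 * l} - C)) * (c * hahn_weight l p i)"
      by (simp only: low up sum_constant cong: sum.cong)
    also have "card ({1..l} - C) = l - i"
      using Ci by (simp add: card_Diff_subset_Int Int_commute)
    \<comment> \<open>\<open>C\<close> has \<open>p - 1 - i\<close> letters in the upper
      half.\<close>
    also have "card ({l + 1..2 * l} - C) = l - p + Suc i"
      using Cu p by (simp add: card_Diff_subset_Int Int_commute)
    finally have "of_nat (l - i) * ?f B = c * (- of_nat (l - p + Suc i) * hahn_weight l p i)"
      by (simp add: eq_neg_iff_add_eq_0 mult.left_commute del: of_nat_add of_nat_Suc)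
    also have "\<dots> = of_nat (l - i) * (c * hahn_weight l p (Suc i))"
      unfolding hahn_weight_Suc[OF il, symmetric] by (simp only: mult_ac)
    finally have "of_nat (l - i) * ?f B = of_nat (l - i) * (c * hahn_weight l p (Suc i))" .
    thus ?case using il by simp
  qed note main = this
  show ?thesis
  proof
    fix T
    show "f T = cscale (f (two_row (2 * l) {l + 1..l + p})) (spherical l p) T"
    proof (cases "T \<in> two_row (2 * l) ` {B. B \<subseteq> {1..2 * l} \<and> card B = p}")
      case True
      then obtain B where "T = two_row (2 * l) B" "B \<subseteq> {1..2 * l}" "card B = p" by blast
      thus ?thesis using main unfolding c_def[symmetric] by (simp add: cscale_def spherical_two_row)
    next
      case False
      thus ?thesis using specht_two_row_support[OF _ f False] p by (simp add: cscale_def spherical_def)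
    qed
  qed
qed



section \<open>The zonal spherical function\<close>

definition avg_K :: "nat \<Rightarrow> (tabloid \<Rightarrow> complex) \<Rightarrow> tabloid \<Rightarrow> complex" where
  "avg_K l f = cscale (1 / of_nat (card (subgroup_K l))) (\<Sum>k\<in>subgroup_K l. tabloid_action k f)"

text \<open>The action involves \<open>inv k\<close>; since inversion permutes \<open>K\<close>, the
  average may be written with \<open>k\<close> itself.\<close>

lemma avg_K_two_row:
  "avg_K l f (two_row (2 * l) B)
    = (\<Sum>k\<in>subgroup_K l. f (two_row (2 * l) (k ` B))) / of_nat (card (subgroup_K l))"
proof -
  have "(\<Sum>k\<in>subgroup_K l. f (two_row (2 * l) (k ` B)))
      = (\<Sum>k\<in>subgroup_K l. tabloid_action k f (two_row (2 * l) B))"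
    unfolding sum_subgroup_K_inv[of "\<lambda>k. f (two_row (2 * l) (k ` B))", symmetric]
    by (intro sum.cong refl) (rule tabloid_action_two_row[OF subgroup_K_permutes, symmetric])
  thus ?thesis by (simp add: avg_K_def cscale_def sum_fun_apply)
qed

lemma avg_K_in_specht:
  assumes "p \<le> l" "f \<in> specht_module [2 * l - p, p]"
  shows "avg_K l f \<in> specht_module [2 * l - p, p]"
proof -
  have "tabloid_action k f \<in> specht_module [2 * l - p, p]" if "k \<in> subgroup_K l" for k
    using assms subgroup_K_permutes[OF that] by (intro tabloid_action_specht_module) auto
  thus ?thesis unfolding avg_K_def specht_module_def
    by (intro cfun.span_scale cfun.span_sum) auto
qed

text \<open>Right translation of the summation index shows that the average is
  \<open>K\<close>-invariant, so \<open>invariant_eq_spherical\<close> applies.\<close>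

lemma avg_K_eq_spherical:
  assumes p: "p \<le> l" and f: "f \<in> specht_module [2 * l - p, p]"
  shows "avg_K l f = cscale (avg_K l f (two_row (2 * l) {l + 1..l + p})) (spherical l p)"
proof (rule invariant_eq_spherical[OF p avg_K_in_specht[OF p f]])
  fix g B assume g: "g \<in> subgroup_K l"
  have "(\<Sum>k\<in>subgroup_K l. F (k \<circ> g)) = (\<Sum>k\<in>subgroup_K l. F k)" for F :: "_ \<Rightarrow> complex"
  proof (rule sum.reindex_bij_witness[of _ "\<lambda>k. k \<circ> inv g" "\<lambda>k. k \<circ> g"])
    note p = permutes_inverses[OF subgroup_K_permutes[OF g]]
    show "(k \<circ> g) \<circ> inv g = k" "(k \<circ> inv g) \<circ> g = k" for k :: "nat \<Rightarrow> nat"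
      by (simp_all add: fun_eq_iff p)
  qed (auto simp: g subgroup_K_inv subgroup_K_comp)
  from this[of "\<lambda>k. f (two_row (2 * l) (k ` B))"]
  show "avg_K l f (two_row (2 * l) (g ` B)) = avg_K l f (two_row (2 * l) B)"
    unfolding avg_K_two_row by (simp add: image_comp)
qed

text \<open>Averages stay in the Specht module and are multiples of the spherical function, so it
  suffices to exhibit one polytabloid with nonzero average.\<close>

lemma spherical_in_specht:
  assumes p: "p \<le> l"
  shows "spherical l p \<in> specht_module [2 * l - p, p]"
proof -
  let ?la = "[2 * l - p, p]"
  \<comment> \<open>The bottom row is \<open>l+1, ..., l+p\<close>, the top row
    \<open>1, ..., l\<close> followed by \<open>l+p+1, ..., 2l\<close>; each of the first
    \<open>p\<close> columns then pairs a letter \<open>j+1\<close> of the lower half with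
    \<open>l+j+1\<close>.\<close>
  define t :: "nat \<times> nat \<Rightarrow> nat" where
    "t = (\<lambda>(i, j). if i = 1 then l + j + 1 else if j < l then j + 1 else j + p + 1)"
  define B0 where "B0 = {l + 1..l + p}"
  have bot: "t ` ({1} \<times> {..<p}) = B0"
  proof
    show "B0 \<subseteq> t ` ({1} \<times> {..<p})"
    proof
      fix x assume "x \<in> B0"
      hence "x = t (1, x - l - 1)" "x - l - 1 < p" by (auto simp: t_def B0_def)
      thus "x \<in> t ` ({1} \<times> {..<p})" by blast
    qed
  qed (auto simp: t_def B0_def)
  have t: "tableau ?la t"
    unfolding tableau_def
  proof (rule bij_betw_byWitness[where f' = "\<lambda>x. if x \<le> l then (0, x - 1)
        else if x \<le> l + p then (1, x - l - 1) else (0, x - p - 1)"])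
  qed (use p in \<open>auto simp: t_def diagram_two_row split: if_splits\<close>)
  define e where "e = polytabloid ?la t"
  have e: "e \<in> specht_module ?la"
    unfolding specht_module_def e_def using t by (blast intro: cfun.span_base)
  have val: "e (two_row (2 * l) (k ` B0)) = of_bool (k ` B0 = B0)" if k: "k \<in> subgroup_K l" for k
  proof -
    have "B0 \<subseteq> {l + 1..2 * l}" using p by (auto simp: B0_def)
    hence kB0: "k ` B0 \<subseteq> {l + 1..2 * l}" using subgroup_K_image_upper[OF k] by blast
    \<comment> \<open>If the bottom row stays in the upper half, no bottom entry can be exchanged
      with the lower letter above it. Hence only the identity contributes and no signs can
      cancel.\<close>
    have only_id: "q = id" if q: "q \<in> column_stabilizer ?la t" "q ` B0 = k ` B0" for q
    proof (rule column_stabilizer_fixing_bottom_row[OF _ t q(1)])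
      show "2 * p \<le> 2 * l" using p by simp
      fix j assume j: "j < p"
      have "t (1, j) \<in> column ?la t j" using j by (force simp: column_def diagram_two_row)
      hence "q (t (1, j)) \<in> column ?la t j" using q(1) by (auto simp: column_stabilizer_def)
      hence "q (t (1, j)) = j + 1 \<or> q (t (1, j)) = t (1, j)"
        using j p by (auto simp: column_def diagram_two_row t_def)
      moreover have "t (1, j) \<in> B0" using j by (simp add: t_def B0_def)
      hence "q (t (1, j)) \<in> {l + 1..2 * l}" using q(2) kB0 by blast
      ultimately show "q (t (1, j)) = t (1, j)" using j p by auto
    qed
    have "id \<in> column_stabilizer ?la t" by (simp add: column_stabilizer_def permutes_id)
    hence "q \<in> column_stabilizer ?la t \<and> q ` B0 = k ` B0 \<longleftrightarrow> q = id \<and> k ` B0 = B0" for q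
      using only_id[of q] by (cases "q = id") (simp add: eq_commute[of B0], blast)
    hence eq: "{q \<in> column_stabilizer ?la t. q ` B0 = k ` B0} = (if k ` B0 = B0 then {id} else {})"
      by simp
    have "p \<le> 2 * l" using p by simp
    have "e (two_row (2 * l) (k ` B0)) = (\<Sum>q\<in>column_stabilizer ?la t. if q ` B0 = k ` B0 then of_int (sign q) else 0)"
      unfolding e_def polytabloid_two_row[OF \<open>p \<le> 2 * l\<close> t] bot by simp
    also have "\<dots> = (\<Sum>q | q \<in> column_stabilizer ?la t \<and> q ` B0 = k ` B0. of_int (sign q))"
      by (simp add: sum.inter_filter finite_column_stabilizer)
    also have "\<dots> = of_bool (k ` B0 = B0)" unfolding eq by (simp add: sign_id)
    finally show ?thesis .
  qed
  \<comment> \<open>By \<open>val\<close> this is the proportion of elements of \<open>K\<close>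
    that stabilise \<open>B0\<close>, which is positive because of \<open>id\<close>.\<close>
  define c where "c = avg_K l e (two_row (2 * l) B0)"
  have "(\<Sum>k\<in>subgroup_K l. e (two_row (2 * l) (k ` B0))) = of_nat (card {k \<in> subgroup_K l. k ` B0 = B0})"
    using finite_subgroup_K[of l] by (simp add: val sum_of_bool_eq Int_def)
  moreover have "card {k \<in> subgroup_K l. k ` B0 = B0} \<noteq> 0"
  proof -
    have "id \<in> {k \<in> subgroup_K l. k ` B0 = B0}" using id_in_subgroup_K by simp
    moreover have "finite {k \<in> subgroup_K l. k ` B0 = B0}" using finite_subgroup_K[of l] by simp
    ultimately show ?thesis by (metis card_eq_0_iff empty_iff)
  qed
  ultimately have "c \<noteq> 0"
    using card_subgroup_K[of l] unfolding c_def avg_K_two_row by simp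
  have "avg_K l e = cscale c (spherical l p)"
    using avg_K_eq_spherical[OF p e] by (simp add: c_def B0_def)
  hence eq: "spherical l p = cscale (1 / c) (avg_K l e)"
    using \<open>c \<noteq> 0\<close> by (simp add: cscale_def fun_eq_iff)
  show ?thesis
    using avg_K_in_specht[OF p e] unfolding eq specht_module_def by (rule cfun.span_scale)
qed

text \<open>
  Averaging over \<open>K\<close> after acting by \<open>h\<close> has rank one on the Specht module, with image spanned by
  the spherical function, so its trace is read off from the value at one tabloid.
\<close>

lemma zonal_two_row:
  assumes p: "p \<le> l" and h: "h permutes {1..2 * l}"
  shows "zonal l [2 * l - p, p] h = (\<Sum>k\<in>subgroup_K l.
      hahn_weight l p (card (k ` {l + 1..l + p} \<inter> h ` {1..l}))) / of_nat (card (subgroup_K l))"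
proof -
  let ?V = "specht_module [2 * l - p, p]"
  define B0 where "B0 = {l + 1..l + p}"
  define D where "D = two_row (2 * l) ` {B. B \<subseteq> {1..2 * l} \<and> card B = p}"
  have D: "finite D" by (simp add: D_def)
  have sub: "cfun.subspace ?V" by (simp add: specht_module_def)
  have supp: "\<forall>v\<in>?V. \<forall>T. T \<notin> D \<longrightarrow> v T = 0"
    using specht_two_row_support[of p "2 * l"] p by (auto simp: D_def)
  have act: "tabloid_action g v \<in> ?V" if "g permutes {1..2 * l}" "v \<in> ?V" for g v
    using that p by (intro tabloid_action_specht_module) auto
  have comp: "tabloid_action (k \<circ> h) v = tabloid_action k (tabloid_action h v)"
    if "k \<in> subgroup_K l" for k v
    by (rule tabloid_action_comp[OF permutes_bij[OF h] permutes_bij[OF subgroup_K_permutes[OF that]]])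
  have kh: "tabloid_action (k \<circ> h) v \<in> ?V" if "k \<in> subgroup_K l" "v \<in> ?V" for k v
    using act[OF permutes_compose[OF h subgroup_K_permutes[OF that(1)]] that(2)] .
  \<comment> \<open>The coefficient of the spherical function in the averaged action on
    \<open>v\<close>, read off at \<open>B0\<close>, where the spherical function equals 1.\<close>
  define \<phi> where "\<phi> v = avg_K l (tabloid_action h v) (two_row (2 * l) B0)" for v
  have "zonal l [2 * l - p, p] h
      = 1 / of_nat (card (subgroup_K l)) * (\<Sum>k\<in>subgroup_K l. trace_on ?V (tabloid_action (k \<circ> h)))"
    by (simp add: zonal_def irr_char_def)
  also have "(\<Sum>k\<in>subgroup_K l. trace_on ?V (tabloid_action (k \<circ> h)))
      = trace_on ?V (\<lambda>v. \<Sum>k\<in>subgroup_K l. tabloid_action (k \<circ> h) v)"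
    by (rule trace_on_sum[OF sub D supp kh])
  also have "1 / of_nat (card (subgroup_K l)) * \<dots>
      = trace_on ?V (\<lambda>v. cscale (1 / of_nat (card (subgroup_K l))) (\<Sum>k\<in>subgroup_K l. tabloid_action (k \<circ> h) v))"
  proof (rule trace_on_scale[OF sub D supp, symmetric])
    fix v assume "v \<in> ?V"
    thus "(\<Sum>k\<in>subgroup_K l. tabloid_action (k \<circ> h) v) \<in> ?V"
      by (intro cfun.subspace_sum[OF sub] kh)
  qed
  also have "\<dots> = \<phi> (spherical l p)"
  proof (rule trace_on_rank_one[OF sub D supp spherical_in_specht[OF p]])
    fix v assume v: "v \<in> ?V"
    have "cscale (1 / of_nat (card (subgroup_K l))) (\<Sum>k\<in>subgroup_K l. tabloid_action (k \<circ> h) v)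
        = avg_K l (tabloid_action h v)"
      by (simp add: avg_K_def comp)
    thus "cscale (1 / of_nat (card (subgroup_K l))) (\<Sum>k\<in>subgroup_K l. tabloid_action (k \<circ> h) v)
        = cscale (\<phi> v) (spherical l p)"
      using avg_K_eq_spherical[OF p act[OF h v]] by (simp add: \<phi>_def B0_def)
  next
    show "\<phi> (v + w) = \<phi> v + \<phi> w" for v w
      by (simp add: \<phi>_def avg_K_two_row tabloid_action_add sum.distrib add_divide_distrib)
    show "\<phi> (cscale c v) = c * \<phi> v" for c v
      unfolding \<phi>_def avg_K_two_row tabloid_action_cscale by (simp add: cscale_def sum_distrib_left)
  qed
  also have "\<phi> (spherical l p) = (\<Sum>k\<in>subgroup_K l.
      hahn_weight l p (card (k ` B0 \<inter> h ` {1..l}))) / of_nat (card (subgroup_K l))"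
    unfolding \<phi>_def avg_K_two_row
  proof (intro arg_cong2[of _ _ _ _ "(/)"] sum.cong refl)
    fix k assume k: "k \<in> subgroup_K l"
    have inj: "inj (inv h)" "inj k" using h k permutes_inv permutes_inj subgroup_K_permutes by blast+
    have "B0 \<subseteq> {1..2 * l}" using p by (auto simp: B0_def)
    hence "inv h ` k ` B0 \<subseteq> {1..2 * l}"
      using permutes_image[OF subgroup_K_permutes[OF k]] permutes_image[OF permutes_inv[OF h]] by blast
    moreover have "card (inv h ` k ` B0) = p"
      using inj by (simp add: card_image inj_on_subset B0_def)
    \<comment> \<open>Transporting by \<open>h\<close> moves it from the subset onto the lower
      half.\<close>
    moreover have "inv h ` k ` B0 \<inter> {1..l} = inv h ` (k ` B0 \<inter> h ` {1..l})"
      using inj(1) by (simp add: image_Int image_image permutes_inverses[OF h])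
    hence "card (inv h ` k ` B0 \<inter> {1..l}) = card (k ` B0 \<inter> h ` {1..l})"
      using inj(1) by (simp add: card_image inj_on_subset)
    ultimately show "tabloid_action h (spherical l p) (two_row (2 * l) (k ` B0))
        = hahn_weight l p (card (k ` B0 \<inter> h ` {1..l}))"
      by (simp add: tabloid_action_two_row[OF h] spherical_two_row)
  qed
  finally show ?thesis by (simp add: B0_def)
qed



section \<open>Averages of binomial coefficients over \<open>K\<close>\<close>

text \<open>\<open>K\<close> is transitive on the \<open>j\<close>-subsets of the upper half, so its
  elements are shared equally among the \<open>l choose j\<close> possible images of
  \<open>J\<close>.\<close>

lemma card_transporter:
  assumes J: "J \<subseteq> {l + 1..2 * l}" "card J = j" and J': "J' \<subseteq> {l + 1..2 * l}" "card J' = j"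
  shows "card {k \<in> subgroup_K l. k ` J = J'} * (l choose j) = card (subgroup_K l)"
proof -
  let ?N = "\<lambda>A. \<Sum>k\<in>subgroup_K l. of_bool (k ` J = A) :: nat"
  let ?U = "{A. A \<subseteq> {l + 1..2 * l} \<and> card A = j}"
  have N: "?N A = ?N J'" if A: "A \<in> ?U" for A
  proof -
    have "A \<inter> {1..l} = {}" "J' \<inter> {1..l} = {}" using A J' by force+
    moreover have "A \<subseteq> {1..2 * l}" "J' \<subseteq> {1..2 * l}" using A J' by force+
    ultimately obtain g where g: "g \<in> subgroup_K l" "g ` A = J'"
      using subgroup_K_transitive[of A l J'] A J' by auto
    have "k ` J = A \<longleftrightarrow> (g \<circ> k) ` J = J'" for k
      using g(2) inj_image_eq_iff[OF permutes_inj[OF subgroup_K_permutes[OF g(1)]], of "k ` J" A]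
      by (simp add: image_image)
    hence "?N A = (\<Sum>k\<in>subgroup_K l. of_bool ((g \<circ> k) ` J = J'))" by simp
    also have "\<dots> = ?N J'" by (rule sum_subgroup_K_comp[OF g(1)])
    finally show ?thesis .
  qed
  have fin: "finite ?U" by simp
  have "card ?U = l choose j" using n_subsets[of "{l + 1..2 * l}" j] by simp
  hence "(l choose j) * ?N J' = (\<Sum>A\<in>?U. ?N A)" using N by simp
  also have "\<dots> = (\<Sum>k\<in>subgroup_K l. \<Sum>A\<in>?U. of_bool (k ` J = A))" by (rule sum.swap)
  also have "\<dots> = (\<Sum>k\<in>subgroup_K l. 1)"
  proof (rule sum.cong[OF refl])
    fix k assume k: "k \<in> subgroup_K l"
    have "card (k ` J) = j"
      using J permutes_inj[OF subgroup_K_permutes[OF k]] by (simp add: card_image inj_on_subset)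
    moreover have "k ` J \<subseteq> {l + 1..2 * l}" using subgroup_K_image_upper[OF k] J(1) by blast
    ultimately have "k ` J \<in> ?U" by simp
    hence "(\<Sum>A\<in>?U. if k ` J = A then 1 else 0) = (1 :: nat)" using fin by (subst sum.delta') auto
    thus "(\<Sum>A\<in>?U. of_bool (k ` J = A)) = (1 :: nat)" by (simp add: of_bool_def)
  qed
  also have "\<dots> = card (subgroup_K l)" by simp
  finally show ?thesis
    using finite_subgroup_K[of l] by (simp add: sum_of_bool_eq Int_def mult.commute)
qed

lemma sum_choose_card_image_Int:
  assumes B: "B \<subseteq> {l + 1..2 * l}"
  shows "(\<Sum>k\<in>subgroup_K l. card (k ` B \<inter> X) choose j) * (l choose j)
    = card (subgroup_K l) * (card B choose j) * (card (X \<inter> {l + 1..2 * l}) choose j)"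
proof -
  let ?sub = "\<lambda>A. {J. J \<subseteq> A \<and> card J = j}"
  have finB: "finite B" using B finite_subset by blast
  have "card (k ` B \<inter> X) choose j
      = (\<Sum>J\<in>?sub B. \<Sum>J'\<in>?sub (X \<inter> {l + 1..2 * l}). of_bool (k ` J = J'))"
    if k: "k \<in> subgroup_K l" for k
  proof -
    have inj: "inj k" using permutes_inj[OF subgroup_K_permutes[OF k]] .
    have "k ` B \<inter> X = k ` {b \<in> B. k b \<in> X}" by auto
    hence "card (k ` B \<inter> X) = card {b \<in> B. k b \<in> X}"
      using inj by (simp add: card_image inj_on_subset)
    hence "card (k ` B \<inter> X) choose j = card (?sub {b \<in> B. k b \<in> X})"
      using n_subsets[of "{b \<in> B. k b \<in> X}" j] finB by simp
    also have "?sub {b \<in> B. k b \<in> X} = {J \<in> ?sub B. k ` J \<subseteq> X}" by blast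
    also have "card \<dots> = (\<Sum>J\<in>?sub B. of_bool (k ` J \<subseteq> X))"
      using finB by (simp add: sum_of_bool_eq Int_def)
    also have "\<dots> = (\<Sum>J\<in>?sub B. \<Sum>J'\<in>?sub (X \<inter> {l + 1..2 * l}). of_bool (k ` J = J'))"
    proof (rule sum.cong[OF refl])
      fix J assume J: "J \<in> ?sub B"
      have "k ` J \<subseteq> {l + 1..2 * l}" using subgroup_K_image_upper[OF k] J B by blast
      moreover have "card (k ` J) = j" using inj J by (simp add: card_image inj_on_subset)
      ultimately have "k ` J \<in> ?sub (X \<inter> {l + 1..2 * l}) \<longleftrightarrow> k ` J \<subseteq> X" by blast
      moreover have "finite (?sub (X \<inter> {l + 1..2 * l}))" by simp
      ultimately have "(\<Sum>J'\<in>?sub (X \<inter> {l + 1..2 * l}). if k ` J = J' then 1 else 0) = (of_bool (k ` J \<subseteq> X) :: nat)"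
        by (subst sum.delta') auto
      thus "of_bool (k ` J \<subseteq> X) = (\<Sum>J'\<in>?sub (X \<inter> {l + 1..2 * l}). of_bool (k ` J = J') :: nat)"
        by (simp add: of_bool_def)
    qed
    finally show ?thesis .
  qed
  hence "(\<Sum>k\<in>subgroup_K l. card (k ` B \<inter> X) choose j)
      = (\<Sum>k\<in>subgroup_K l. \<Sum>J\<in>?sub B. \<Sum>J'\<in>?sub (X \<inter> {l + 1..2 * l}). of_bool (k ` J = J'))"
    by (rule sum.cong[OF refl])
  also have "\<dots> = (\<Sum>J\<in>?sub B. \<Sum>J'\<in>?sub (X \<inter> {l + 1..2 * l}). \<Sum>k\<in>subgroup_K l. of_bool (k ` J = J'))"
    by (subst sum.swap, intro sum.cong refl, rule sum.swap)
  finally have "(\<Sum>k\<in>subgroup_K l. card (k ` B \<inter> X) choose j) * (l choose j)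
      = (\<Sum>J\<in>?sub B. \<Sum>J'\<in>?sub (X \<inter> {l + 1..2 * l}).
          (\<Sum>k\<in>subgroup_K l. of_bool (k ` J = J')) * (l choose j))"
    by (simp only: sum_distrib_right)
  also have "\<dots> = (\<Sum>J\<in>?sub B. \<Sum>J'\<in>?sub (X \<inter> {l + 1..2 * l}). card (subgroup_K l))"
  proof (intro sum.cong refl)
    fix J J' assume "J \<in> ?sub B" "J' \<in> ?sub (X \<inter> {l + 1..2 * l})"
    hence "card {k \<in> subgroup_K l. k ` J = J'} * (l choose j) = card (subgroup_K l)"
      using B by (intro card_transporter) auto
    thus "(\<Sum>k\<in>subgroup_K l. of_bool (k ` J = J')) * (l choose j) = card (subgroup_K l)"
      using finite_subgroup_K[of l] by (simp add: sum_of_bool_eq Int_def)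
  qed
  also have "\<dots> = card (subgroup_K l) * (card B choose j) * (card (X \<inter> {l + 1..2 * l}) choose j)"
    using n_subsets[OF finB, of j] n_subsets[of "X \<inter> {l + 1..2 * l}" j] by simp
  finally show ?thesis .
qed

text \<open>Expanding the weight in binomials of the intersection size reduces the average over
  \<open>K\<close> to the means \<open>(p choose j) (s choose j) / (l choose j)\<close>, which
  produce the Hahn sum. The argument works for every permutation \<open>h\<close>.\<close>

lemma zonal_eq_hahn_Q:
  assumes p: "p \<le> l" and h: "h permutes {1..2 * l}"
  shows "zonal l [2 * l - p, p] h
    = hahn_Q p (of_nat (card (h ` {1..l} \<inter> {l + 1..2 * l}))) (- of_nat l - 1) (- of_nat l - 1) l"
proof -
  define B where "B = {l + 1..l + p}"
  define X where "X = h ` {1..l}"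
  define s where "s = card (X \<inter> {l + 1..2 * l})"
  define m where "m = (of_nat (card (subgroup_K l)) :: complex)"
  define a where "a j = ((-1) ^ j * of_nat ((2 * l + 1 - p) choose j) / of_nat (l choose j) :: complex)" for j
  have B: "B \<subseteq> {l + 1..2 * l}" "card B = p" using p by (auto simp: B_def)
  have m: "m \<noteq> 0" using card_subgroup_K[of l] by (simp add: m_def)
  \<comment> \<open>The upper limit \<open>p\<close> does not depend on \<open>i\<close>, so that
    the sums over \<open>j\<close> and \<open>k\<close> can be interchanged.\<close>
  have w: "hahn_weight l p i = (\<Sum>j=0..p. a j * of_nat (i choose j))" if "i \<le> p" for i
  proof -
    have "hahn_weight l p i = (\<Sum>j=0..i. a j * of_nat (i choose j))"
      using that p by (subst hahn_weight_expand[symmetric]) (auto simp: a_def mult_ac)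
    also have "\<dots> = (\<Sum>j=0..p. a j * of_nat (i choose j))"
      using that by (intro sum.mono_neutral_left) auto
    finally show ?thesis .
  qed
  have le: "card (k ` B \<inter> X) \<le> p" if "k \<in> subgroup_K l" for k
  proof -
    have "finite B" by (simp add: B_def)
    hence "card (k ` B \<inter> X) \<le> card (k ` B)" "card (k ` B) \<le> card B"
      by (auto intro: card_mono card_image_le)
    thus ?thesis using B(2) by simp
  qed
  have avg: "(\<Sum>k\<in>subgroup_K l. of_nat (card (k ` B \<inter> X) choose j))
      = m * (of_nat (p choose j) * of_nat (s choose j) / of_nat (l choose j))" if "j \<le> p" for j
  proof -
    have "of_nat ((\<Sum>k\<in>subgroup_K l. card (k ` B \<inter> X) choose j) * (l choose j))
        = m * (of_nat (p choose j) * of_nat (s choose j))"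
      unfolding sum_choose_card_image_Int[OF B(1)] B(2) s_def[symmetric] m_def by simp
    moreover have "(of_nat (l choose j) :: complex) \<noteq> 0" using that p by simp
    ultimately show ?thesis by (simp add: eq_divide_eq)
  qed
  have "zonal l [2 * l - p, p] h = (\<Sum>k\<in>subgroup_K l. \<Sum>j=0..p. a j * of_nat (card (k ` B \<inter> X) choose j)) / m"
    unfolding zonal_two_row[OF assms] B_def[symmetric] X_def[symmetric] m_def[symmetric]
    by (simp add: w le cong: sum.cong)
  also have "\<dots> = (\<Sum>j=0..p. a j * (\<Sum>k\<in>subgroup_K l. of_nat (card (k ` B \<inter> X) choose j))) / m"
    by (subst sum.swap) (simp add: sum_distrib_left)
  also have "\<dots> = (\<Sum>j=0..p. a j * (of_nat (p choose j) * of_nat (s choose j) / of_nat (l choose j)))"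
  proof -
    have "(\<Sum>j=0..p. a j * (\<Sum>k\<in>subgroup_K l. of_nat (card (k ` B \<inter> X) choose j)))
        = (\<Sum>j=0..p. m * (a j * (of_nat (p choose j) * of_nat (s choose j) / of_nat (l choose j))))"
      by (intro sum.cong refl) (simp add: avg)
    thus ?thesis using m unfolding sum_distrib_left[symmetric] by simp
  qed
  also have "\<dots> = hahn_Q p (of_nat s) (- of_nat l - 1) (- of_nat l - 1) l"
    unfolding hahn_Q_eq[OF p] a_def by (simp add: mult_ac)
  finally show ?thesis by (simp add: s_def X_def)
qed

section \<open>The group \<open>H\<close>\<close>

text \<open>For \<open>S \<subseteq> {1..l}\<close> this is the product of the disjoint
  transpositions of \<open>x\<close> and \<open>x + l\<close> over \<open>x\<close> in
  \<open>S\<close>; it parametrises \<open>H\<close> by subsets.\<close>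

definition swap_pairs :: "nat \<Rightarrow> nat set \<Rightarrow> nat \<Rightarrow> nat" where
  "swap_pairs l S x = (if x \<in> S then x + l else if l < x \<and> x - l \<in> S then x - l else x)"

lemma swap_pairs_involutive:
  assumes "S \<subseteq> {1..l}"
  shows "swap_pairs l S (swap_pairs l S x) = x"
  using assms by (auto simp: swap_pairs_def)

lemma swap_pairs_permutes:
  assumes "S \<subseteq> {1..l}"
  shows "swap_pairs l S permutes {1..2 * l}"
proof (rule bij_imp_permutes)
  have "swap_pairs l S x \<in> {1..2 * l}" if "x \<in> {1..2 * l}" for x
    using that assms by (auto simp: swap_pairs_def)
  thus "bij_betw (swap_pairs l S) {1..2 * l} {1..2 * l}"
    by (intro bij_betw_byWitness[where f' = "swap_pairs l S"])
       (auto simp: swap_pairs_involutive[OF assms] simp del: atLeastAtMost_iff)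
  show "swap_pairs l S x = x" if "x \<notin> {1..2 * l}" for x
    using that subsetD[OF assms, of x] subsetD[OF assms, of "x - l"] by (auto simp: swap_pairs_def)
qed

lemma cong_pairs:
  fixes x y :: nat
  assumes "x \<in> {1..l}" "y \<in> {1..2 * l}" "[y = x] (mod l)"
  shows "y = x \<or> y = x + l"
proof -
  \<comment> \<open>Letters start at 1, so \<open>l\<close> is the representative of residue 0 and
    needs its own case.\<close>
  have eq: "u = v" if "u \<in> {1..l}" "v \<in> {1..l}" "u mod l = v mod l" for u v :: nat
    using that by (cases "u = l"; cases "v = l") auto
  show ?thesis
  proof (cases "y \<le> l")
    case True
    thus ?thesis using eq[of y x] assms by (auto simp: cong_def)
  next
    case False
    hence "(y - l) mod l = x mod l" using assms by (simp add: cong_def le_mod_geq[of l y])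
    moreover have "y - l \<in> {1..l}" using assms(2) False by auto
    ultimately have "y - l = x" using eq assms(1) by blast
    thus ?thesis using False by arith
  qed
qed

lemma subgroup_H_eq: "subgroup_H l = swap_pairs l ` Pow {1..l}"
proof
  show "swap_pairs l ` Pow {1..l} \<subseteq> subgroup_H l"
  proof clarify
    fix S assume S: "S \<subseteq> {1..l}"
    have "[swap_pairs l S x = x] (mod l)" for x
      by (auto simp: swap_pairs_def cong_def le_mod_geq[of l x])
    thus "swap_pairs l S \<in> subgroup_H l"
      using swap_pairs_permutes[OF S] by (simp add: subgroup_H_def)
  qed
  show "subgroup_H l \<subseteq> swap_pairs l ` Pow {1..l}"
  proof
    fix h assume "h \<in> subgroup_H l"
    hence h: "h permutes {1..2 * l}" and cong: "\<And>x. x \<in> {1..2 * l} \<Longrightarrow> [h x = x] (mod l)"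
      by (auto simp: subgroup_H_def)
    have inj: "h x = h y \<longleftrightarrow> x = y" for x y using permutes_inj[OF h] by (auto simp: inj_def)
    have range: "h x \<in> {1..2 * l}" if "x \<in> {1..2 * l}" for x
      using that permutes_in_image[OF h] by blast
    \<comment> \<open>Each class \<open>{x, x + l}\<close> is preserved by \<open>h\<close>, which
      by injectivity either fixes or swaps it; the lower letters moved therefore determine
      \<open>h\<close>.\<close>
    define S where "S = {x \<in> {1..l}. h x \<noteq> x}"
    have low: "h x = x \<or> h x = x + l" if x: "x \<in> {1..l}" for x
      using x by (intro cong_pairs range cong) auto
    have up: "h (x + l) = x \<or> h (x + l) = x + l" if x: "x \<in> {1..l}" for x
    proof (intro cong_pairs x range)
      have "[h (x + l) = x + l] (mod l)" using x by (intro cong) auto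
      thus "[h (x + l) = x] (mod l)" by (simp add: cong_def)
    qed (use x in auto)
    have pair: "h x = swap_pairs l S x \<and> h (x + l) = swap_pairs l S (x + l)" if x: "x \<in> {1..l}" for x
    proof -
      have "x + l \<notin> S" "x \<noteq> x + l" using x by (auto simp: S_def)
      thus ?thesis
        using x low[OF x] up[OF x] inj[of x "x + l"] by (auto simp: swap_pairs_def S_def)
    qed
    have "h x = swap_pairs l S x" for x
    proof -
      consider "x \<in> {1..l}" | "x - l \<in> {1..l}" "x = (x - l) + l" | "x \<notin> {1..2 * l}" by force
      thus ?thesis
      proof cases
        case 3
        moreover have "S \<subseteq> {1..l}" by (auto simp: S_def)
        ultimately show ?thesis
          using permutes_not_in[OF h 3] permutes_not_in[OF swap_pairs_permutes 3] by metis
      qed (use pair in metis)+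
    qed
    moreover have "S \<in> Pow {1..l}" by (auto simp: S_def)
    ultimately show "h \<in> swap_pairs l ` Pow {1..l}" by blast
  qed
qed

lemma inj_on_swap_pairs: "inj_on (swap_pairs l) (Pow {1..l})"
proof
  fix S T assume S: "S \<in> Pow {1..l}" and T: "T \<in> Pow {1..l}" and eq: "swap_pairs l S = swap_pairs l T"
  have "R = {x \<in> {1..l}. swap_pairs l R x \<noteq> x}" if "R \<in> Pow {1..l}" for R
    using that by (auto simp: swap_pairs_def)
  from this[OF S] this[OF T] show "S = T" by (simp add: eq)
qed

lemma card_swap_pairs_Int:
  assumes S: "S \<subseteq> {1..l}"
  shows "card (swap_pairs l S ` {1..l} \<inter> {l + 1..2 * l}) = card S"
proof -
  have "swap_pairs l S ` {1..l} \<inter> {l + 1..2 * l} = (\<lambda>x. x + l) ` S"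
    using S by (auto simp: swap_pairs_def image_iff split: if_splits)
  thus ?thesis by (simp add: card_image)
qed

text \<open>The inductive \<open>orbit\<close> starts at \<open>f x\<close>, so \<open>x\<close>
  itself enters only with the second application.\<close>

lemma orbit_involution:
  assumes "\<And>x. f (f x) = x"
  shows "orbit f x = {x, f x}"
proof
  show "orbit f x \<subseteq> {x, f x}"
  proof
    fix y assume "y \<in> orbit f x"
    thus "y \<in> {x, f x}" by induction (auto simp: assms)
  qed
  have "f x \<in> orbit f x" by (rule orbit.base)
  moreover from orbit.step[OF this] have "x \<in> orbit f x" by (simp add: assms)
  ultimately show "{x, f x} \<subseteq> orbit f x" by simp
qed

lemma nu_swap_pairs:
  assumes S: "S \<subseteq> {1..l}"
  shows "nu (2 * l) (swap_pairs l S) = card S"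
proof -
  let ?h = "swap_pairs l S"
  \<comment> \<open>One representative per cycle: the lower letter of each swapped pair, and both
    letters of each fixed pair.\<close>
  define R where "R = {1..l} \<union> (\<lambda>x. x + l) ` ({1..l} - S)"
  have orb: "orbit ?h x = {x, ?h x}" for x
    by (rule orbit_involution[OF swap_pairs_involutive[OF S]])
  have "orbit ?h ` {1..2 * l} = orbit ?h ` R"
  proof
    show "orbit ?h ` R \<subseteq> orbit ?h ` {1..2 * l}" by (intro image_mono) (auto simp: R_def)
    show "orbit ?h ` {1..2 * l} \<subseteq> orbit ?h ` R"
    proof
      fix O' assume "O' \<in> orbit ?h ` {1..2 * l}"
      then obtain x where x: "x \<in> {1..2 * l}" "O' = orbit ?h x" by blast
      show "O' \<in> orbit ?h ` R"
      proof (cases "x \<in> R")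
        case False
        hence lx: "l < x" using x by (auto simp: R_def)
        have "x \<noteq> (x - l) + l \<or> x - l \<notin> {1..l} - S" using False unfolding R_def by blast
        hence xS: "x - l \<in> S" using lx x by auto
        hence "?h x = x - l" "x - l \<in> R" using S lx by (auto simp: swap_pairs_def R_def)
        moreover from this have "O' = orbit ?h (x - l)"
          using x(2) swap_pairs_involutive[OF S, of x] by (simp add: orb insert_commute)
        ultimately show ?thesis by blast
      qed (use x in blast)
    qed
  qed
  moreover have "inj_on (orbit ?h) R"
  proof
    fix x y assume "x \<in> R" "y \<in> R" "orbit ?h x = orbit ?h y"
    \<comment> \<open>In the second case \<open>y\<close> must be fixed, since \<open>R\<close>
      holds only one letter of a swapped pair.\<close>
    hence "x = y \<or> x = ?h y" by (auto simp: orb doubleton_eq_iff)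
    thus "x = y" using \<open>x \<in> R\<close> \<open>y \<in> R\<close> S by (auto simp: R_def swap_pairs_def split: if_splits)
  qed
  moreover have "card R = l + (l - card S)"
  proof -
    have "finite S" using S finite_subset by blast
    moreover have "{1..l} \<inter> (\<lambda>x. x + l) ` ({1..l} - S) = {}" by auto
    ultimately show ?thesis using S
      unfolding R_def by (subst card_Un_disjoint) (auto simp: card_image card_Diff_subset)
  qed
  moreover have "card S \<le> l" using card_mono[OF _ S] by simp
  ultimately show ?thesis by (simp add: nu_def card_image)
qed

section \<open>Summation over \<open>H\<close>\<close>

lemma sum_Pow_card:
  fixes F :: "nat \<Rightarrow> 'a :: comm_semiring_1"
  assumes "finite A"
  shows "(\<Sum>S\<in>Pow A. F (card S)) = (\<Sum>s=0..card A. of_nat (card A choose s) * F s)"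
proof -
  have "(\<Sum>S\<in>Pow A. F (card S)) = (\<Sum>s=0..card A. \<Sum>S | S \<in> Pow A \<and> card S = s. F (card S))"
    using assms by (intro sum.group[symmetric]) (auto intro: card_mono)
  also have "\<dots> = (\<Sum>s=0..card A. of_nat (card A choose s) * F s)"
    using n_subsets[OF assms] by (intro sum.cong refl) simp
  finally show ?thesis .
qed

text \<open>Both the exponent \<open>nu\<close> and the argument of the Hahn polynomial at
  \<open>swap_pairs l S\<close> equal \<open>card S\<close>, so the sum over \<open>H\<close> is
  grouped by the size of \<open>S\<close>.\<close>

lemma F2_eq_sum_hahn_Q:
  assumes "p \<le> l"
  shows "F2 l [2 * l - p, p] \<alpha> = (\<Sum>s=0..l. of_nat (l choose s)
    * hahn_Q p (of_nat s) (- of_nat l - 1) (- of_nat l - 1) l * \<alpha> ^ s)"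
proof -
  let ?Q = "\<lambda>s. hahn_Q p (of_nat s) (- of_nat l - 1) (- of_nat l - 1) l"
  have "F2 l [2 * l - p, p] \<alpha>
      = (\<Sum>S\<in>Pow {1..l}. \<alpha> ^ nu (2 * l) (swap_pairs l S) * zonal l [2 * l - p, p] (swap_pairs l S))"
    unfolding F2_def subgroup_H_eq by (subst sum.reindex[OF inj_on_swap_pairs]) simp
  also have "\<dots> = (\<Sum>S\<in>Pow {1..l}. \<alpha> ^ card S * ?Q (card S))"
  proof (rule sum.cong[OF refl])
    fix S assume "S \<in> Pow {1..l}"
    hence S: "S \<subseteq> {1..l}" by simp
    show "\<alpha> ^ nu (2 * l) (swap_pairs l S) * zonal l [2 * l - p, p] (swap_pairs l S)
        = \<alpha> ^ card S * ?Q (card S)"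
      unfolding nu_swap_pairs[OF S] zonal_eq_hahn_Q[OF assms swap_pairs_permutes[OF S]]
        card_swap_pairs_Int[OF S] ..
  qed
  also have "\<dots> = (\<Sum>s=0..l. of_nat (l choose s) * (\<alpha> ^ s * ?Q s))"
    using sum_Pow_card[of "{1..l}" "\<lambda>s. \<alpha> ^ s * ?Q s"] by simp
  finally show ?thesis by (simp add: mult_ac)
qed

theorem theorem6p11:
  fixes l p :: nat and \<alpha> :: complex
  assumes "l > 0" and "p \<le> l"
  shows "F2 l [2 * l - p, p] \<alpha>
           = (\<Sum>s=0..l. of_nat (l choose s)
                * hahn_Q p (of_nat s) (- of_nat l - 1) (- of_nat l - 1) l * \<alpha> ^ s)
       \<and> (\<Sum>s=0..l. of_nat (l choose s)
                * hahn_Q p (of_nat s) (- of_nat l - 1) (- of_nat l - 1) l * \<alpha> ^ s)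
           = (1 + \<alpha>) ^ (l - p) * G_poly p (of_nat l) \<alpha>"
  using F2_eq_sum_hahn_Q[OF assms(2)] sum_hahn_Q[OF assms(2)] by blast

end
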